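(* Let $\sigma$ be any finite signature, $P$ a $\sigma$-program with $\mathrm{Lab}_P^{\mathrm{fin}}\ne\emptyset$, and $A$ any first-order structure of an arbitrary signature, with universe $U_A$. Then: (i) Each Gödel number $\nu_{\vec\ell}$ of a program path $\vec\ell\in\mathrm{Lab}_P^{\mathrm{fin}}$ can be index-generated and stored into one index register of any arbitrary $A$-machine. (ii) The set of all these Gödel numbers is index-enumerable by a BSS RAM over $A$ that computes the function $\mathrm{enum}_{P,\mathrm{ind}}:U_A^\infty\to\bigcup_{u\in U_A}\{u\}^\infty$. (iii) Each Gödel number $\nu_{\vec\ell}$ of a finite $P$-path $\vec\ell=(\ell_1,\ldots,\ell_s)\in L_P^s$ can be evaluated by a BSS RAM over $A$: for $i\le s$, the single component $\ell_i$ of the path can be computed and assigned to an index register.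
   Context: **Programs.** Let $\sigma=(n_1;m_1,\ldots,m_{n_2};k_1,\ldots,k_{n_3})$ be a finite signature with constant symbols $c_i^0$, operation symbols $f_i^{m_i}$, relation symbols $r_i^{k_i}$. A $\sigma$-program $P$ is a list $1:\mathrm{instruction}_1;\ \ldots;\ \ell_P-1:\mathrm{instruction}_{\ell_P-1};\ \ell_P:\text{stop}$ with $\ell_P\ge1$, where each instruction with label $\ell<\ell_P$ has one of the forms: (1) $Z_j:=f_i^{m_i}(Z_{j_1},\ldots,Z_{j_{m_i}})$; (2) $Z_j:=c_i^0$; (3) $Z_{I_j}:=Z_{I_k}$; (4) if $r_i^{k_i}(Z_{j_1},\ldots,Z_{j_{k_i}})$ then goto $\ell_1'$ else goto $\ell_2'$; (5) if $I_j=I_k$ then goto $\ell_1'$ else goto $\ell_2'$; (6) $I_j:=1$; (7) $I_j:=I_j+1$; (11) goto $\ell_1'$ or goto $\ell_2'$; with $\ell_1',\ell_2'\in L_P=\{1,\ldots,\ell_P\}$. Types (5)–(7) are called index instructions. Let $L_P^{\circ}=\{1,\ldots,\ell_P-1\}$, $L_P^{\mathrm B}$ = labels of types (4),(5),(11), $L_P^{\mathrm{NB}}=L_P^\circ\setminus L_P^{\mathrm B}$. Put $\beta_P(\ell)=\ell+1$ for $\ell\in L_P^{\mathrm{NB}}$ and, for $\ell\in L_P^{\mathrm B}$, $\beta_P^+(\ell)=\ell_1'$, $\beta_P^-(\ell)=\ell_2'$. **Finite $P$-paths.** A finite $P$-path of length $s\ge1$ is $(\ell_1,\ldots,\ell_s)\in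 L_P^s$ with $\ell_1=1$, $\ell_s=\ell_P$, $\ell_t\in L_P^\circ$ for $t<s$, and for all $t<s$: $\ell_{t+1}=\beta_P(\ell_t)$ if $\ell_t\in L_P^{\mathrm{NB}}$, $\ell_{t+1}\in\{\beta_P^+(\ell_t),\beta_P^-(\ell_t)\}$ if $\ell_t\in L_P^{\mathrm B}$. $\mathrm{Lab}_P^{\mathrm{fin}}$ is the set of all finite $P$-paths. **Order and enumeration.** Order $\mathrm{Lab}_P^{\mathrm{fin}}$ by length first and, for equal length, lexicographically (with $1<2<\cdots<\ell_P$); write $\le_P^{\mathrm{fin}}$. If $\mathrm{Lab}_P^{\mathrm{fin}}$ is infinite, $\mathrm{enum}_P^{(O)}(\vec 1^{[n]})$ is the $n$-th path in this order; if it has $i_0\geq 1$ elements, $\mathrm{enum}_P^{(O)}(\vec1^{[n]})$ is the $\min(n,i_0)$-th path. Here $\vec u^{[n]}=(u,\ldots,u)\in\{u\}^n$ and $\{u\}^\infty=\bigcup_{n\ge1}\{u\}^n$. **Gödel numbers.** Let $p_1<p_2<\cdots$ be the sequence of all primes. The Gödel number of $\vec\ell=(\ell_1,\ldots,\ell_s)$ is $\nu_{\vec\ell}=2^{\ell_1}3^{\ell_2}\cdots p_s^{\ell_s}$. For $\vec x\in U_A^n$ ($n\ge1$) put $u=x_1$ and $\mathrm{enum}_{P,\mathrm{ind}}(\vec x)=\vec u^{[\nu_{\vec\ell}]}$ where $\vec\ell=\mathrm{enum}_P^{(O)}(\vec 1^{[n]})$. **BSS RAMs and index computation.** For a structure $A$,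 a (deterministic) BSS RAM $M$ over $A$ is given by a program, that is, a list $1:\mathrm{instruction}_1;\ \ldots;\ q-1:\mathrm{instruction}_{q-1};\ q:\text{stop}$ with $q\ge1$ in which each instruction with label less than $q$ has one of the forms (1) $Z_j:=f_i^{m_i}(Z_{j_1},\ldots,Z_{j_{m_i}})$, (2) $Z_j:=c_i^0$, (3) $Z_{I_j}:=Z_{I_k}$, (4) if $r_i^{k_i}(Z_{j_1},\ldots,Z_{j_{k_i}})$ then goto $q_1$ else goto $q_2$, (5) if $I_j=I_k$ then goto $q_1$ else goto $q_2$, (6) $I_j:=1$, (7) $I_j:=I_j+1$, with $q_1,q_2\in\{1,\ldots,q\}$ and with $f_i^{m_i}$, $c_i^0$, $r_i^{k_i}$ operation, constant and relation symbols from a finite part of the signature of $A$ (interpreted in $A$), and by finitely many index registers $I_1,\ldots,I_{k_M}$ with values in $\mathbb N_+$; it has registers $Z_1,Z_2,\ldots$ with values in $U_A$. On input $\vec x\in U_A^n$ it starts at label $1$ with index values $(n,1,\ldots,1)$ and $Z$-values $(x_1,\ldots,x_n,x_n,x_n,\ldots)$; instructions are executed in the obvious way (type (3) copies the content of $Z_{c(I_k)}$ into $Z_{c(I_j)}$, where $c(\cdot)$ denotes register content); at stop the output is $(c(Z_1),\ldots,c(Z_{c(I_1)}))$. More generally an $A$-machine is any machine of this kind (deterministic or non-deterministic) with index registers and $Z$-registers. A number is index-generated (index-computed) if it is obtained by executing only index instructions, without using the $Z$-registers; a set of numbers is index-enumerable if its elements form a sequence whose $n$-th member is index-computable from the index $n$.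 *)

theory Defs
  imports "HOL-Library.FuncSet" "HOL-Library.Infinite_Set" "HOL-Computational_Algebra.Primes"
begin

section \<open>Signatures and first-order structures\<close>

text \<open>Symbols are the elements of three arbitrary, possibly infinite sets.\<close>

record ('c, 'f, 'r) fo_signature =
  const_syms :: "'c set"
  op_syms :: "'f set"
  rel_syms :: "'r set"
  op_arity :: "'f \<Rightarrow> nat"
  rel_arity :: "'r \<Rightarrow> nat"

definition finite_signature :: "('c, 'f, 'r) fo_signature \<Rightarrow> bool" where
  "finite_signature S \<longleftrightarrow> finite (const_syms S) \<and> finite (op_syms S) \<and> finite (rel_syms S)"

record ('c, 'f, 'r, 'u) fo_structure =
  sig_of :: "('c, 'f, 'r) fo_signature"
  universe :: "'u set"
  const_val :: "'c \<Rightarrow> 'u"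
  op_val :: "'f \<Rightarrow> 'u list \<Rightarrow> 'u"
  rel_val :: "'r \<Rightarrow> 'u list \<Rightarrow> bool"

definition is_fo_structure :: "('c, 'f, 'r, 'u) fo_structure \<Rightarrow> bool" where
  "is_fo_structure A \<longleftrightarrow>
     universe A \<noteq> {} \<and>
     (\<forall>c \<in> const_syms (sig_of A). const_val A c \<in> universe A) \<and>
     (\<forall>f \<in> op_syms (sig_of A). \<forall>xs.
        length xs = op_arity (sig_of A) f \<and> set xs \<subseteq> universe A \<longrightarrow> op_val A f xs \<in> universe A)"

text \<open>\<open>tuples X\<close> is the union of the powers \<open>X\<^sup>n\<close> over \<open>n \<ge> 1\<close>.\<close>

definition tuples :: "'a set \<Rightarrow> 'a list set" where
  "tuples X = {xs. xs \<noteq> [] \<and> set xs \<subseteq> X}"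


section \<open>Programs\<close>

text \<open>
  The instruction types, in this order: \<open>Z\<^sub>j := f(Z\<^sub>j\<^sub>1, \<dots>)\<close>; \<open>Z\<^sub>j := c\<close>; the copy of
  \<open>Z\<close> with index \<open>c(I\<^sub>k)\<close> into \<open>Z\<close> with index \<open>c(I\<^sub>j)\<close>; the test of a relation;
  the test \<open>I\<^sub>j = I\<^sub>k\<close>; \<open>I\<^sub>j := 1\<close>; \<open>I\<^sub>j := I\<^sub>j + 1\<close>; the non-deterministic
  \<open>goto l1 or goto l2\<close>.
\<close>

datatype ('c, 'f, 'r) instr =
    Z_Op nat 'f "nat list"
  | Z_Const nat 'c
  | Z_Copy nat nat
  | Rel_Test 'r "nat list" nat nat
  | I_Test nat nat nat nat
  | I_One nat
  | I_Inc nat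
  | Goto_Or nat nat

text \<open>
  A program is the list of its instructions without the final \<open>stop\<close>.  Labels count from 1, so
  the instruction with label \<open>l\<close> is \<open>P ! (l - 1)\<close>, and \<open>stop\<close> has the label \<open>length P + 1\<close>.
\<close>

type_synonym ('c, 'f, 'r) program = "('c, 'f, 'r) instr list"

definition stop_label :: "('c, 'f, 'r) program \<Rightarrow> nat" where
  "stop_label P = length P + 1"

definition instr_at :: "('c, 'f, 'r) program \<Rightarrow> nat \<Rightarrow> ('c, 'f, 'r) instr" where
  "instr_at P l = P ! (l - 1)"

definition labels :: "('c, 'f, 'r) program \<Rightarrow> nat set" where
  "labels P = {1..stop_label P}"

definition nonstop_labels :: "('c, 'f, 'r) program \<Rightarrow> nat set" where
  "nonstop_labels P = {1..<stop_label P}"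

fun is_index_instr :: "('c, 'f, 'r) instr \<Rightarrow> bool" where
  "is_index_instr (I_Test _ _ _ _) = True"
| "is_index_instr (I_One _) = True"
| "is_index_instr (I_Inc _) = True"
| "is_index_instr _ = False"

fun is_goto_or :: "('c, 'f, 'r) instr \<Rightarrow> bool" where
  "is_goto_or (Goto_Or _ _) = True"
| "is_goto_or _ = False"

text \<open>The two jump targets of a branching instruction, \<open>None\<close> for all other instructions.\<close>

fun branch :: "('c, 'f, 'r) instr \<Rightarrow> (nat \<times> nat) option" where
  "branch (Rel_Test _ _ l1 l2) = Some (l1, l2)"
| "branch (I_Test _ _ l1 l2) = Some (l1, l2)"
| "branch (Goto_Or l1 l2) = Some (l1, l2)"
| "branch _ = None"

text \<open>
  \<open>wf_instr S J L\<close>: symbols and arities agree with \<open>S\<close>, \<open>Z\<close>-registers are numbered from 1,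
  index registers have numbers in \<open>J\<close>, jump targets lie in \<open>L\<close>.
\<close>

fun wf_instr ::
  "('c, 'f, 'r) fo_signature \<Rightarrow> nat set \<Rightarrow> nat set \<Rightarrow> ('c, 'f, 'r) instr \<Rightarrow> bool" where
  "wf_instr S J L (Z_Op j f js) \<longleftrightarrow>
     f \<in> op_syms S \<and> length js = op_arity S f \<and> 1 \<le> j \<and> (\<forall>i \<in> set js. 1 \<le> i)"
| "wf_instr S J L (Z_Const j c) \<longleftrightarrow> c \<in> const_syms S \<and> 1 \<le> j"
| "wf_instr S J L (Z_Copy j k) \<longleftrightarrow> j \<in> J \<and> k \<in> J"
| "wf_instr S J L (Rel_Test r js l1 l2) \<longleftrightarrow>
     r \<in> rel_syms S \<and> length js = rel_arity S r \<and> (\<forall>i \<in> set js. 1 \<le> i) \<and> l1 \<in> L \<and> l2 \<in> L"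
| "wf_instr S J L (I_Test j k l1 l2) \<longleftrightarrow> j \<in> J \<and> k \<in> J \<and> l1 \<in> L \<and> l2 \<in> L"
| "wf_instr S J L (I_One j) \<longleftrightarrow> j \<in> J"
| "wf_instr S J L (I_Inc j) \<longleftrightarrow> j \<in> J"
| "wf_instr S J L (Goto_Or l1 l2) \<longleftrightarrow> l1 \<in> L \<and> l2 \<in> L"

definition sigma_program :: "('c, 'f, 'r) fo_signature \<Rightarrow> ('c, 'f, 'r) program \<Rightarrow> bool" where
  "sigma_program S P \<longleftrightarrow> (\<forall>ins \<in> set P. wf_instr S {1..} (labels P) ins)"


section \<open>Finite paths, their enumeration and their Goedel numbers\<close>

definition label_succ :: "('c, 'f, 'r) program \<Rightarrow> nat \<Rightarrow> nat \<Rightarrow> bool" where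
  "label_succ P l l' \<longleftrightarrow>
     (case branch (instr_at P l) of
        None \<Rightarrow> l' = l + 1
      | Some (l1, l2) \<Rightarrow> l' \<in> {l1, l2})"

definition fin_paths :: "('c, 'f, 'r) program \<Rightarrow> nat list set" where
  "fin_paths P = {ls.
     ls \<noteq> [] \<and> set ls \<subseteq> labels P \<and> hd ls = 1 \<and> last ls = stop_label P \<and>
     (\<forall>t. t + 1 < length ls \<longrightarrow>
        ls ! t \<in> nonstop_labels P \<and> label_succ P (ls ! t) (ls ! (t + 1)))}"

text \<open>\<open>lenlex\<close> compares lengths first and lists of equal length lexicographically.\<close>

definition path_le :: "nat list \<Rightarrow> nat list \<Rightarrow> bool" where
  "path_le ks ls \<longleftrightarrow> ks = ls \<or> (ks, ls) \<in> lenlex less_than"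

definition nth_path :: "('c, 'f, 'r) program \<Rightarrow> nat \<Rightarrow> nat list" where
  "nth_path P n = (THE ls. ls \<in> fin_paths P \<and> card {ks \<in> fin_paths P. path_le ks ls} = n)"

text \<open>The argument \<open>n\<close> stands for the tuple \<open>(1, \<dots>, 1)\<close> of length \<open>n \<ge> 1\<close>.\<close>

definition enum_O :: "('c, 'f, 'r) program \<Rightarrow> nat \<Rightarrow> nat list" where
  "enum_O P n =
     (if infinite (fin_paths P) then nth_path P n else nth_path P (min n (card (fin_paths P))))"

text \<open>\<open>enumerate {p. prime p} 0 = 2\<close>, \<open>enumerate {p. prime p} 1 = 3\<close>, and so on.\<close>

definition goedel :: "nat list \<Rightarrow> nat" where
  "goedel ls = (\<Prod>i<length ls. enumerate {p::nat. prime p} i ^ (ls ! i))"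

definition enum_ind :: "('c, 'f, 'r) program \<Rightarrow> 'u list \<Rightarrow> 'u list" where
  "enum_ind P xs = replicate (goedel (enum_O P (length xs))) (hd xs)"


section \<open>Machines\<close>

text \<open>\<open>regs M\<close> is the number of index registers.\<close>

record ('c, 'f, 'r) machine =
  prog :: "('c, 'f, 'r) program"
  regs :: nat

definition A_machine :: "('c, 'f, 'r, 'u) fo_structure \<Rightarrow> ('c, 'f, 'r) machine \<Rightarrow> bool" where
  "A_machine A M \<longleftrightarrow>
     1 \<le> regs M \<and>
     (\<forall>ins \<in> set (prog M). wf_instr (sig_of A) {1..regs M} (labels (prog M)) ins)"

definition bss_ram :: "('c, 'f, 'r, 'u) fo_structure \<Rightarrow> ('c, 'f, 'r) machine \<Rightarrow> bool" where
  "bss_ram A M \<longleftrightarrow> A_machine A M \<and> (\<forall>ins \<in> set (prog M). \<not> is_goto_or ins)"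

text \<open>
  A configuration consists of the current label, the contents of the index registers and the
  contents of the \<open>Z\<close>-registers.  Registers are numbered from 1; the value at 0 and the index
  registers beyond \<open>regs M\<close> are never accessed by a machine \<open>M\<close>.
\<close>

type_synonym 'u config = "nat \<times> (nat \<Rightarrow> nat) \<times> (nat \<Rightarrow> 'u)"

definition proper_state ::
  "('c, 'f, 'r, 'u) fo_structure \<Rightarrow> (nat \<Rightarrow> nat) \<Rightarrow> (nat \<Rightarrow> 'u) \<Rightarrow> bool" where
  "proper_state A I Z \<longleftrightarrow> (\<forall>j\<ge>1. 1 \<le> I j \<and> Z j \<in> universe A)"

fun exec ::
  "('c, 'f, 'r, 'u) fo_structure \<Rightarrow> ('c, 'f, 'r) instr \<Rightarrow> 'u config \<Rightarrow> 'u config set" where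
  "exec A (Z_Op j f js) (l, I, Z) = {(l + 1, I, Z(j := op_val A f (map Z js)))}"
| "exec A (Z_Const j c) (l, I, Z) = {(l + 1, I, Z(j := const_val A c))}"
| "exec A (Z_Copy j k) (l, I, Z) = {(l + 1, I, Z(I j := Z (I k)))}"
| "exec A (Rel_Test r js l1 l2) (l, I, Z) = {(if rel_val A r (map Z js) then l1 else l2, I, Z)}"
| "exec A (I_Test j k l1 l2) (l, I, Z) = {(if I j = I k then l1 else l2, I, Z)}"
| "exec A (I_One j) (l, I, Z) = {(l + 1, I(j := 1), Z)}"
| "exec A (I_Inc j) (l, I, Z) = {(l + 1, I(j := I j + 1), Z)}"
| "exec A (Goto_Or l1 l2) (l, I, Z) = {(l1, I, Z), (l2, I, Z)}"

definition step ::
  "('c, 'f, 'r, 'u) fo_structure \<Rightarrow> ('c, 'f, 'r) machine \<Rightarrow> 'u config \<Rightarrow> 'u config \<Rightarrow> bool" where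
  "step A M c c' \<longleftrightarrow>
     fst c \<in> nonstop_labels (prog M) \<and> c' \<in> exec A (instr_at (prog M) (fst c)) c"

text \<open>Input procedure: index values \<open>(n, 1, \<dots>, 1)\<close>, \<open>Z\<close>-values \<open>(x\<^sub>1, \<dots>, x\<^sub>n, x\<^sub>n, \<dots>)\<close>.\<close>

definition init_config :: "'u list \<Rightarrow> 'u config" where
  "init_config xs =
     (1, (\<lambda>j. if j = 1 then length xs else 1), (\<lambda>j. xs ! (min j (length xs) - 1)))"

definition output_of :: "(nat \<Rightarrow> nat) \<Rightarrow> (nat \<Rightarrow> 'u) \<Rightarrow> 'u list" where
  "output_of I Z = map Z [1..<I 1 + 1]"

definition halts_in ::
  "('c, 'f, 'r, 'u) fo_structure \<Rightarrow> ('c, 'f, 'r) machine \<Rightarrow> 'u config \<Rightarrow>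
     (nat \<Rightarrow> nat) \<Rightarrow> (nat \<Rightarrow> 'u) \<Rightarrow> bool" where
  "halts_in A M c I Z \<longleftrightarrow> (step A M)\<^sup>*\<^sup>* c (stop_label (prog M), I, Z)"

text \<open>Used for BSS RAMs only, whose runs are unique; so the existence of a halting run suffices.\<close>

definition computes ::
  "('c, 'f, 'r, 'u) fo_structure \<Rightarrow> ('c, 'f, 'r) machine \<Rightarrow> ('u list \<Rightarrow> 'u list) \<Rightarrow> bool" where
  "computes A M g \<longleftrightarrow>
     (\<forall>xs \<in> tuples (universe A). \<exists>I Z. halts_in A M (init_config xs) I Z \<and> output_of I Z = g xs)"


section \<open>Index computation\<close>

text \<open>Steps that execute an index instruction whose label lies in \<open>L\<close>.\<close>

definition index_step ::
  "('c, 'f, 'r, 'u) fo_structure \<Rightarrow> ('c, 'f, 'r) machine \<Rightarrow> nat set \<Rightarrow>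
     'u config \<Rightarrow> 'u config \<Rightarrow> bool" where
  "index_step A M L c c' \<longleftrightarrow>
     step A M c c' \<and> fst c \<in> L \<and> is_index_instr (instr_at (prog M) (fst c))"

fun relabel :: "(nat \<Rightarrow> nat) \<Rightarrow> ('c, 'f, 'r) instr \<Rightarrow> ('c, 'f, 'r) instr" where
  "relabel h (Rel_Test r js l1 l2) = Rel_Test r js (h l1) (h l2)"
| "relabel h (I_Test j k l1 l2) = I_Test j k (h l1) (h l2)"
| "relabel h (Goto_Or l1 l2) = Goto_Or (h l1) (h l2)"
| "relabel h ins = ins"

text \<open>
  A block has its own labels \<open>1, \<dots>, length B\<close>; its exit is the label \<open>length B + 1\<close>.
  \<open>insert_block B p M\<close> inserts \<open>B\<close> after the first \<open>p\<close> instructions of \<open>M\<close>: the block occupies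
  the labels from \<open>p + 1\<close> to \<open>p + length B\<close>, and its exit is the instruction that had label
  \<open>p + 1\<close> in \<open>M\<close>.  Jumps of \<open>M\<close> to \<open>p + 1\<close> enter the block.
\<close>

definition insert_block ::
  "('c, 'f, 'r) program \<Rightarrow> nat \<Rightarrow> ('c, 'f, 'r) machine \<Rightarrow> ('c, 'f, 'r) machine" where
  "insert_block B p M =
     (let h = relabel (\<lambda>l. if l \<le> p + 1 then l else l + length B)
      in M\<lparr>prog := map h (take p (prog M)) @ map (relabel (\<lambda>l. l + p)) B
                   @ map h (drop p (prog M))\<rparr>)"

text \<open>
  \<open>index_generates A M j v\<close>: a block of index instructions, using only the index registers that
  \<open>M\<close> has, can be inserted at any place of the program of \<open>M\<close>, and from every state its execution
  stores \<open>v\<close> into \<open>I\<^sub>j\<close> and leaves all other registers unchanged.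
\<close>

definition index_generates ::
  "('c, 'f, 'r, 'u) fo_structure \<Rightarrow> ('c, 'f, 'r) machine \<Rightarrow> nat \<Rightarrow> nat \<Rightarrow> bool" where
  "index_generates A M j v \<longleftrightarrow>
     (\<exists>B. (\<forall>ins \<in> set B. is_index_instr ins \<and> wf_instr (sig_of A) {1..regs M} (labels B) ins) \<and>
        (\<forall>p \<le> length (prog M).
           A_machine A (insert_block B p M) \<and>
           (\<forall>I Z. proper_state A I Z \<longrightarrow>
              (index_step A (insert_block B p M) {p + 1..p + length B})\<^sup>*\<^sup>*
                (p + 1, I, Z) (p + length B + 1, I(j := v), Z))))"

text \<open>
  \<open>index_computes A M g\<close>: on every input of length \<open>n\<close>, the machine \<open>M\<close> executes only index
  instructions until it arrives at label \<open>q\<close> for the first time, and then \<open>I\<^sub>j\<close> contains \<open>g n\<close>.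
  Since index steps start at labels different from \<open>q\<close>, the first arrival is meant.
\<close>

definition index_computes ::
  "('c, 'f, 'r, 'u) fo_structure \<Rightarrow> ('c, 'f, 'r) machine \<Rightarrow> (nat \<Rightarrow> nat) \<Rightarrow> bool" where
  "index_computes A M g \<longleftrightarrow>
     (\<exists>q \<in> labels (prog M). \<exists>j \<in> {1..regs M}. \<forall>xs \<in> tuples (universe A). \<exists>I Z.
        (index_step A M (- {q}))\<^sup>*\<^sup>* (init_config xs) (q, I, Z) \<and> I j = g (length xs))"

definition index_enumerates ::
  "('c, 'f, 'r, 'u) fo_structure \<Rightarrow> ('c, 'f, 'r) machine \<Rightarrow> (nat \<Rightarrow> nat) \<Rightarrow> nat set \<Rightarrow> bool" where
  "index_enumerates A M g S \<longleftrightarrow> g ` {1..} = S \<and> index_computes A M g"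

end

theory Submission
  imports Defs
begin

text \<open>
  Index instructions alone form a counter machine, and its loops yield all functions that arise
  from the successor by primitive recursion and unbounded search.  It remains to describe the
  enumeration by such operations.  The entries of a path are the exponents in its Goedel number,
  hence ``\<open>g\<close> is the Goedel number of a path'' and the order of two paths are decidable from
  the Goedel numbers.  If \<open>ks\<close> precedes \<open>ls\<close> and \<open>q\<close> is the largest label, then
  \<open>goedel ks \<le> goedel ls ^ q\<close>, because all entries lie between 1 and \<open>q\<close>.  So the rank of a path
  is a bounded count, and the \<open>n\<close>-th Goedel number is found by searching for rank \<open>n\<close>.
\<close>

section \<open>Blocks of instructions\<close>

text \<open>Compiled arithmetic is not generated from a syntax of recursive functions. Computability
  is a predicate on HOL functions of the register contents, with one closure rule per operation, so
  a defining formula is shown computable by following its own structure; bound variables are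
  modelled by arbitrary computable functions. This keeps formulas as large as the one for being a
  path manageable.

  The machines depend on \<open>P\<close>, and only their existence is claimed. Hence facts about
  \<open>P\<close> enter as constants: the table of jump targets and, if there are only finitely
  many paths, their number. The latter is essential: a search for a rank beyond the number of paths
  would never end, so the argument is capped before the search starts.

  Storing one fixed Goedel number in an arbitrary machine is a separate matter. That machine may
  have no spare register, so compiled arithmetic is of no use there and the number is produced by
  increments alone.\<close>

definition shift :: "nat \<Rightarrow> ('c, 'f, 'r) program \<Rightarrow> ('c, 'f, 'r) program" where
  "shift p B = map (relabel (\<lambda>l. l + p)) B"

lemma length_shift [simp]: "length (shift p B) = length B"
  by (simp add: shift_def)

lemma relabel_relabel: "relabel h (relabel g ins) = relabel (\<lambda>l. h (g l)) ins"
  by (cases ins) auto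

lemma shift_shift: "shift p (shift n B) = shift (n + p) B"
  by (simp add: shift_def relabel_relabel add.assoc)

lemma shift_append: "shift p (B @ C) = shift p B @ shift p C"
  by (simp add: shift_def)

lemma shift_Cons: "shift p (x # C) = relabel (\<lambda>l. l + p) x # shift p C"
  by (simp add: shift_def)

lemma is_index_instr_relabel [simp]: "is_index_instr (relabel h ins) = is_index_instr ins"
  by (cases ins) auto

lemma is_goto_or_relabel [simp]: "is_goto_or (relabel h ins) = is_goto_or ins"
  by (cases ins) auto

lemma wf_instr_relabel:
  assumes "wf_instr S J L ins" "\<And>l. l \<in> L \<Longrightarrow> h l \<in> L'"
  shows "wf_instr S J L' (relabel h ins)"
  using assms by (cases ins) auto

lemma wf_instr_mono:
  assumes "wf_instr S J L ins" "J \<subseteq> J'" "L \<subseteq> L'"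
  shows "wf_instr S J' L' ins"
  using assms by (cases ins) auto

definition embeds :: "('c, 'f, 'r) program \<Rightarrow> nat \<Rightarrow> ('c, 'f, 'r) program \<Rightarrow> bool" where
  "embeds B p Q \<longleftrightarrow> (\<exists>X Y. Q = X @ shift p B @ Y \<and> length X = p)"

lemma embeds_self:
  fixes B :: "('c, 'f, 'r) program"
  shows "embeds B 0 B"
proof -
  have "relabel (\<lambda>l. l) ins = ins" for ins :: "('c, 'f, 'r) instr"
    by (cases ins) auto
  then have "shift 0 B = B"
    by (auto simp: shift_def intro: map_idI)
  then show ?thesis
    by (force simp: embeds_def)
qed

lemma embeds_appendD:
  assumes "embeds (B @ C) p Q" "C = shift (length B) D"
  shows "embeds B p Q" "embeds D (p + length B) Q"
proof -
  obtain X Y where Q: "Q = X @ shift p (B @ C) @ Y" "length X = p"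
    using assms(1) by (auto simp: embeds_def)
  show "embeds B p Q"
    unfolding embeds_def using Q
    by (intro exI[where x = X] exI[where x = "shift p C @ Y"]) (simp add: shift_append)
  show "embeds D (p + length B) Q"
    unfolding embeds_def using Q assms(2)
    by (intro exI[where x = "X @ shift p B"] exI[where x = Y])
      (simp add: shift_append shift_shift add.commute)
qed

lemma embeds_nth:
  assumes "embeds B p Q" "1 \<le> l" "l \<le> length B"
  shows "instr_at Q (p + l) = relabel (\<lambda>l. l + p) (B ! (l - 1))" "p + l \<in> nonstop_labels Q"
proof -
  obtain X Y where "Q = X @ shift p B @ Y" "length X = p"
    using assms(1) by (auto simp: embeds_def)
  then show "instr_at Q (p + l) = relabel (\<lambda>l. l + p) (B ! (l - 1))" "p + l \<in> nonstop_labels Q"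
    using assms(2,3) by (auto simp: instr_at_def nonstop_labels_def stop_label_def nth_append shift_def)
qed

section \<open>Runs confined to a block\<close>

definition step_in ::
  "('c, 'f, 'r, 'u) fo_structure \<Rightarrow> ('c, 'f, 'r) machine \<Rightarrow> nat set \<Rightarrow>
     'u config \<Rightarrow> 'u config \<Rightarrow> bool" where
  "step_in A M L c c' \<longleftrightarrow> step A M c c' \<and> fst c \<in> L"

lemma step_in_rtranclp_mono:
  "(step_in A M L)\<^sup>*\<^sup>* c c' \<Longrightarrow> L \<subseteq> L' \<Longrightarrow> (step_in A M L')\<^sup>*\<^sup>* c c'"
  by (rule rtranclp_mono[THEN predicate2D, rotated]) (auto simp: step_in_def)

text \<open>Quantifying over all host machines and all offsets makes the meaning of a block
  independent of its surroundings, so one fact serves for sub-blocks, inserted blocks and whole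
  programs. The label range records that control does not leave the block before its exit.\<close>

definition blk ::
  "('c, 'f, 'r, 'u) fo_structure \<Rightarrow> ('c, 'f, 'r) program \<Rightarrow>
     (nat \<Rightarrow> nat) \<times> (nat \<Rightarrow> 'u) \<Rightarrow> (nat \<Rightarrow> nat) \<times> (nat \<Rightarrow> 'u) \<Rightarrow> bool" where
  "blk A B s s' \<longleftrightarrow>
     (\<forall>M p. embeds B p (prog M) \<longrightarrow>
        (step_in A M {p + 1..p + length B})\<^sup>*\<^sup>* (p + 1, s) (p + length B + 1, s'))"

lemma blkD:
  "blk A B s s' \<Longrightarrow> embeds B p (prog M) \<Longrightarrow> {p + 1..p + length B} \<subseteq> L \<Longrightarrow>
     (step_in A M L)\<^sup>*\<^sup>* (p + 1, s) (p + length B + 1, s')"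
  unfolding blk_def by (meson step_in_rtranclp_mono)

lemma blk_single:
  fixes A :: "('c, 'f, 'r, 'u) fo_structure"
  assumes "\<And>l. (l + 1, s') \<in> exec A ins (l, s)" "branch ins = None"
  shows "blk A [ins] s s'"
  unfolding blk_def
proof (intro allI impI)
  fix M :: "('c, 'f, 'r) machine" and p
  assume e: "embeds [ins] p (prog M)"
  have r: "relabel h ins = ins" for h
    using assms(2) by (cases ins) auto
  have "step_in A M {p + 1..p + length [ins]} (p + 1, s) (p + length [ins] + 1, s')"
    using embeds_nth[OF e, of 1] assms(1)[of "p + 1"] by (auto simp: step_in_def step_def r)
  then show "(step_in A M {p + 1..p + length [ins]})\<^sup>*\<^sup>* (p + 1, s) (p + length [ins] + 1, s')"
    by blast
qed

lemma blk_One: "blk A [I_One j] (I, Z) (I(j := 1), Z)"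
  by (rule blk_single) auto

lemma blk_Inc: "blk A [I_Inc j] (I, Z) (I(j := Suc (I j)), Z)"
  by (rule blk_single) auto

lemma blk_Copy: "blk A [Z_Copy j k] (I, Z) (I, Z(I j := Z (I k)))"
  by (rule blk_single) auto

section \<open>Sequential composition and loops\<close>

definition seqb :: "('c, 'f, 'r) program \<Rightarrow> ('c, 'f, 'r) program \<Rightarrow> ('c, 'f, 'r) program"
    (infixr \<open>;;\<close> 60) where
  "B ;; C = B @ shift (length B) C"

lemma length_seqb [simp]: "length (B ;; C) = length B + length C"
  by (simp add: seqb_def)

lemma blk_seqb:
  fixes A :: "('c, 'f, 'r, 'u) fo_structure"
  assumes "blk A B s s'" "blk A C s' s''"
  shows "blk A (B ;; C) s s''"
  unfolding blk_def
proof (intro allI impI)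
  fix M :: "('c, 'f, 'r) machine" and p
  assume "embeds (B ;; C) p (prog M)"
  note e = embeds_appendD[OF this[unfolded seqb_def] refl]
  show "(step_in A M {p + 1..p + length (B ;; C)})\<^sup>*\<^sup>* (p + 1, s) (p + length (B ;; C) + 1, s'')"
    using blkD[OF assms(1) e(1), of "{p + 1..p + length (B ;; C)}"]
      blkD[OF assms(2) e(2), of "{p + 1..p + length (B ;; C)}"]
    by (auto simp: add.assoc intro: rtranclp_trans)
qed

text \<open>\<open>I_Test 1 1 1 1\<close> serves as an unconditional jump to label 1.\<close>

definition loop :: "nat \<Rightarrow> nat \<Rightarrow> ('c, 'f, 'r) program \<Rightarrow> ('c, 'f, 'r) program" where
  "loop j k B = I_Test j k (length B + 3) 2 # shift 1 B @ [I_Test 1 1 1 1]"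

lemma length_loop [simp]: "length (loop j k B) = length B + 2"
  by (simp add: loop_def)

lemma step_in_loop_test:
  assumes "embeds (loop j k B) p (prog M)"
  shows "step_in A M {p + 1..p + length (loop j k B)} (p + 1, I, Z)
           (if I j = I k then p + length (loop j k B) + 1 else p + 2, I, Z)"
  using embeds_nth[OF assms, of 1] by (auto simp: step_in_def step_def loop_def add.commute)

lemma blk_loop_exit:
  assumes "I j = I k"
  shows "blk A (loop j k B) (I, Z) (I, Z)"
  unfolding blk_def using assms step_in_loop_test[of j k B _ _ A I Z] by (auto intro!: r_into_rtranclp)

lemma blk_loop_iterate:
  fixes A :: "('c, 'f, 'r, 'u) fo_structure"
  assumes "I j \<noteq> I k" "blk A B (I, Z) (I', Z')" "blk A (loop j k B) (I', Z') s"
  shows "blk A (loop j k B) (I, Z) s"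
  unfolding blk_def
proof (intro allI impI)
  fix M :: "('c, 'f, 'r) machine" and p
  let ?W = "loop j k B"
  let ?L = "{p + 1..p + length ?W}"
  assume e: "embeds ?W p (prog M)"
  \<comment> \<open>Regrouped so that the prefix before \<open>shift 1 B\<close> has length 1; in
    this form \<open>embeds_appendD\<close> exhibits \<open>B\<close> at offset
    \<open>p + 1\<close>.\<close>
  have "embeds ([I_Test j k (length B + 3) 2] @ shift 1 B) p (prog M)"
    using e embeds_appendD(1)[of "I_Test j k (length B + 3) 2 # shift 1 B" "[I_Test 1 1 1 1]" p "prog M"]
    unfolding embeds_def loop_def by (auto simp: shift_append shift_Cons)
  then have eB: "embeds B (p + 1) (prog M)"
    using embeds_appendD(2) by fastforce
  have 1: "step_in A M ?L (p + 1, I, Z) (p + 2, I, Z)"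
    using step_in_loop_test[OF e, of A I Z] assms(1) by auto
  have 2: "(step_in A M ?L)\<^sup>*\<^sup>* (p + 2, I, Z) (p + length B + 2, I', Z')"
    using blkD[OF assms(2) eB, of ?L] by auto
  have 3: "step_in A M ?L (p + length B + 2, I', Z') (p + 1, I', Z')"
    using embeds_nth[OF e, of "length B + 2"]
    by (auto simp: step_in_def step_def loop_def nth_append)
  have 4: "(step_in A M ?L)\<^sup>*\<^sup>* (p + 1, I', Z') (p + length ?W + 1, s)"
    by (rule blkD[OF assms(3) e]) auto
  show "(step_in A M ?L)\<^sup>*\<^sup>* (p + 1, I, Z) (p + length ?W + 1, s)"
    using 1 2 3 4 by (meson converse_rtranclp_into_rtranclp rtranclp_trans)
qed

text \<open>Total-correctness rule for while loops. The variant \<open>m\<close> reads index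
  registers only, since all loops are driven by counters; the invariant also sees the
  \<open>Z\<close>-registers, for the loop that writes the output.\<close>

lemma blk_loop:
  fixes m :: "(nat \<Rightarrow> nat) \<Rightarrow> nat"
  assumes "Inv I Z"
    and "\<And>I Z. Inv I Z \<Longrightarrow> I j \<noteq> I k \<Longrightarrow> \<exists>I' Z'. blk A B (I, Z) (I', Z') \<and> Inv I' Z' \<and> m I' < m I"
  shows "\<exists>I' Z'. blk A (loop j k B) (I, Z) (I', Z') \<and> Inv I' Z' \<and> I' j = I' k"
  using assms(1)
proof (induction "m I" arbitrary: I Z rule: less_induct)
  case less
  show ?case
  proof (cases "I j = I k")
    case True
    then show ?thesis
      using blk_loop_exit less.prems by blast
  next
    case False
    then show ?thesis
      using assms(2)[OF less.prems] less.hyps blk_loop_iterate by metis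
  qed
qed

text \<open>Register numbers only have to be at least 1 here. The finite number of registers is
  fixed at the end, when the whole program of a machine is known.\<close>

definition index_block :: "('c, 'f, 'r, 'u) fo_structure \<Rightarrow> ('c, 'f, 'r) program \<Rightarrow> bool" where
  "index_block A B \<longleftrightarrow> sigma_program (sig_of A) B \<and> (\<forall>ins \<in> set B. is_index_instr ins)"

lemma sigma_program_seqb:
  assumes "sigma_program S B" "sigma_program S C"
  shows "sigma_program S (B ;; C)"
proof -
  have "wf_instr S {1..} (labels (B ;; C)) ins" if "ins \<in> set B" for ins
    using assms(1) that
    by (auto simp: sigma_program_def labels_def stop_label_def elim!: wf_instr_mono)
  moreover have "wf_instr S {1..} (labels (B ;; C)) (relabel (\<lambda>l. l + length B) ins)"
    if "ins \<in> set C" for ins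
    using assms(2) that
    by (auto simp: sigma_program_def labels_def stop_label_def elim!: wf_instr_relabel)
  ultimately show ?thesis
    by (auto simp: sigma_program_def seqb_def shift_def)
qed

lemma sigma_program_loop:
  assumes "sigma_program S B" "1 \<le> j" "1 \<le> k"
  shows "sigma_program S (loop j k B)"
proof -
  have "wf_instr S {1..} (labels (loop j k B)) (relabel (\<lambda>l. l + 1) ins)" if "ins \<in> set B" for ins
    using assms(1) that
    by (auto simp: sigma_program_def labels_def stop_label_def elim!: wf_instr_relabel)
  then show ?thesis
    using assms(2,3) by (auto simp: sigma_program_def loop_def shift_def labels_def stop_label_def)
qed

lemma index_block_One: "1 \<le> j \<Longrightarrow> index_block A [I_One j]"
  by (simp add: index_block_def sigma_program_def)

lemma index_block_Inc: "1 \<le> j \<Longrightarrow> index_block A [I_Inc j]"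
  by (simp add: index_block_def sigma_program_def)

lemma index_block_seqb: "index_block A B \<Longrightarrow> index_block A C \<Longrightarrow> index_block A (B ;; C)"
  unfolding index_block_def using sigma_program_seqb[of "sig_of A" B C]
  by (auto simp: seqb_def shift_def)

lemma index_block_loop: "index_block A B \<Longrightarrow> 1 \<le> j \<Longrightarrow> 1 \<le> k \<Longrightarrow> index_block A (loop j k B)"
  unfolding index_block_def using sigma_program_loop[of "sig_of A" B j k]
  by (auto simp: loop_def shift_def)

lemmas index_block_intros =
  index_block_One index_block_Inc index_block_seqb index_block_loop

text \<open>Index registers can only be reset, incremented and compared, so a copy has to count up
  from 1 to the content of register \<open>k\<close>. Resetting \<open>j\<close> would destroy the
  source if \<open>j = k\<close>.\<close>

definition assign :: "nat \<Rightarrow> nat \<Rightarrow> ('c, 'f, 'r) program" where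
  "assign j k = [I_One j] ;; loop j k [I_Inc j]"

lemma index_block_assign: "1 \<le> j \<Longrightarrow> 1 \<le> k \<Longrightarrow> index_block A (assign j k)"
  unfolding assign_def by (intro index_block_intros)

lemma blk_assign:
  assumes "1 \<le> I k" "j \<noteq> k"
  shows "blk A (assign j k) (I, Z) (I(j := I k), Z)"
proof -
  have "\<exists>I' Z'. blk A (loop j k [I_Inc j]) (I(j := 1), Z) (I', Z') \<and>
          ((\<exists>n. n \<le> I k \<and> I' = I(j := n)) \<and> Z' = Z) \<and> I' j = I' k"
  proof (rule blk_loop[where m = "\<lambda>J. I k - J j"])
    show "(\<exists>n. n \<le> I k \<and> I(j := 1) = I(j := n)) \<and> Z = Z"
      using assms by blast
    fix J W
    assume J: "(\<exists>n. n \<le> I k \<and> J = I(j := n)) \<and> W = Z" "J j \<noteq> J k"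
    then obtain n where n: "n \<le> I k" "n \<noteq> I k" "J = I(j := n)" "W = Z"
      using assms(2) by auto
    have "blk A [I_Inc j] (J, W) (I(j := Suc n), Z)"
      using blk_Inc[of A j J W] n by simp
    then show "\<exists>I' Z'. blk A [I_Inc j] (J, W) (I', Z') \<and>
        ((\<exists>n. n \<le> I k \<and> I' = I(j := n)) \<and> Z' = Z) \<and> I k - I' j < I k - J j"
      using n by (intro exI[of _ "I(j := Suc n)"] exI[of _ Z]) (auto simp: Suc_le_eq intro!: exI[of _ "Suc n"])
  qed
  then have "blk A (loop j k [I_Inc j]) (I(j := 1), Z) (I(j := I k), Z)"
    using assms(2) by auto
  then show ?thesis
    unfolding assign_def using blk_One blk_seqb by fast
qed

section \<open>Functions computed by index instructions\<close>

definition positive :: "(nat \<Rightarrow> nat) \<Rightarrow> bool" where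
  "positive I \<longleftrightarrow> (\<forall>j\<ge>1. 1 \<le> I j)"

lemma positive_upd [simp]: "positive I \<Longrightarrow> 1 \<le> v \<Longrightarrow> positive (I(j := v))"
  by (simp add: positive_def)

text \<open>
  Register contents are at least 1; content \<open>v + 1\<close> represents the number \<open>v\<close>.  The registers
  above \<open>s + 1\<close> are scratch space.
\<close>

definition delivers ::
  "('c, 'f, 'r, 'u) fo_structure \<Rightarrow> nat \<Rightarrow> ('c, 'f, 'r) program \<Rightarrow> ((nat \<Rightarrow> nat) \<Rightarrow> nat) \<Rightarrow> bool" where
  "delivers A s B f \<longleftrightarrow>
     (\<forall>I Z. positive I \<longrightarrow>
        (\<exists>I'. blk A B (I, Z) (I', Z) \<and> positive I' \<and> (\<forall>j\<in>{1..s}. I' j = I j) \<and>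
          I' (Suc s) = Suc (f (\<lambda>j. I j - 1))))"

definition determined :: "nat \<Rightarrow> ((nat \<Rightarrow> nat) \<Rightarrow> 'a) \<Rightarrow> bool" where
  "determined r f \<longleftrightarrow> (\<forall>x y. (\<forall>j\<in>{1..r}. x j = y j) \<longrightarrow> f x = f y)"

text \<open>A block must exist for every \<open>s \<ge> r\<close>, so that a compound block can keep
  its own values in the registers up to a larger \<open>s\<close> while a sub-block runs. The
  registers above \<open>r\<close> may then differ from the starting state, and
  \<open>determined\<close> ensures that the sub-block still yields the same value of
  \<open>f\<close>.\<close>

definition cmp :: "('c, 'f, 'r, 'u) fo_structure \<Rightarrow> nat \<Rightarrow> ((nat \<Rightarrow> nat) \<Rightarrow> nat) \<Rightarrow> bool" where
  "cmp A r f \<longleftrightarrow> determined r f \<and> (\<forall>s\<ge>r. \<exists>B. index_block A B \<and> delivers A s B f)"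

lemma determinedD: "determined r f \<Longrightarrow> (\<And>j. 1 \<le> j \<Longrightarrow> j \<le> r \<Longrightarrow> x j = y j) \<Longrightarrow> f x = f y"
  by (auto simp: determined_def)

lemma cmpD: "cmp A r f \<Longrightarrow> r \<le> s \<Longrightarrow> \<exists>B. index_block A B \<and> delivers A s B f"
  by (simp add: cmp_def)

lemma cmp_determined: "cmp A r f \<Longrightarrow> determined r f"
  by (simp add: cmp_def)

lemma deliversD:
  assumes "delivers A s B f" "positive I"
  obtains I' where "blk A B (I, Z) (I', Z)" "positive I'" "\<And>j. 1 \<le> j \<Longrightarrow> j \<le> s \<Longrightarrow> I' j = I j"
    "I' (Suc s) = Suc (f (\<lambda>j. I j - 1))"
  using assms unfolding delivers_def by force

lemma cmp_mono: "cmp A r f \<Longrightarrow> r \<le> t \<Longrightarrow> cmp A t f"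
  unfolding cmp_def determined_def by fastforce

lemma cmp_var:
  assumes "1 \<le> j" "j \<le> r"
  shows "cmp A r (\<lambda>x. x j)"
  unfolding cmp_def
proof (intro conjI allI impI)
  show "determined r (\<lambda>x. x j)"
    using assms by (simp add: determined_def)
  fix s assume s: "r \<le> s"
  have "delivers A s (assign (Suc s) j) (\<lambda>x. x j)"
    unfolding delivers_def
  proof (intro allI impI)
    fix I Z assume I: "positive I"
    then have "1 \<le> I j"
      using assms by (simp add: positive_def)
    then show "\<exists>I'. blk A (assign (Suc s) j) (I, Z) (I', Z) \<and> positive I' \<and>
        (\<forall>j\<in>{1..s}. I' j = I j) \<and> I' (Suc s) = Suc (I j - 1)"
      using I s assms blk_assign[of I j "Suc s" A Z]
      by (intro exI[of _ "I(Suc s := I j)"]) auto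
  qed
  then show "\<exists>B. index_block A B \<and> delivers A s B (\<lambda>x. x j)"
    using index_block_assign[of "Suc s" j] assms by auto
qed

lemma cmp_0: "cmp A r (\<lambda>x. 0)"
  unfolding cmp_def
proof (intro conjI allI impI)
  fix s
  have "delivers A s [I_One (Suc s)] (\<lambda>x. 0)"
    unfolding delivers_def
  proof (intro allI impI)
    fix I Z assume "positive I"
    then show "\<exists>I'. blk A [I_One (Suc s)] (I, Z) (I', Z) \<and> positive I' \<and>
        (\<forall>j\<in>{1..s}. I' j = I j) \<and> I' (Suc s) = Suc 0"
      using blk_One[of A "Suc s" I Z] by (intro exI[of _ "I(Suc s := 1)"]) auto
  qed
  then show "\<exists>B. index_block A B \<and> delivers A s B (\<lambda>x. 0)"
    using index_block_One[of "Suc s" A] by auto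
qed (simp add: determined_def)

lemma cmp_Suc:
  assumes "cmp A r f"
  shows "cmp A r (\<lambda>x. Suc (f x))"
  unfolding cmp_def
proof (intro conjI allI impI)
  show "determined r (\<lambda>x. Suc (f x))"
    using cmp_determined[OF assms] by (simp add: determined_def)
  fix s assume "r \<le> s"
  then obtain B where B: "index_block A B" "delivers A s B f"
    using assms cmpD by blast
  have "delivers A s (B ;; [I_Inc (Suc s)]) (\<lambda>x. Suc (f x))"
    unfolding delivers_def
  proof (intro allI impI)
    fix I Z assume "positive I"
    from deliversD[OF B(2) this, where Z = Z] obtain I' where I': "blk A B (I, Z) (I', Z)" "positive I'"
      "\<And>j. 1 \<le> j \<Longrightarrow> j \<le> s \<Longrightarrow> I' j = I j" "I' (Suc s) = Suc (f (\<lambda>j. I j - 1))"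
      by blast
    show "\<exists>I'. blk A (B ;; [I_Inc (Suc s)]) (I, Z) (I', Z) \<and> positive I' \<and>
        (\<forall>j\<in>{1..s}. I' j = I j) \<and> I' (Suc s) = Suc (Suc (f (\<lambda>j. I j - 1)))"
      using blk_seqb[OF I'(1) blk_Inc[of A "Suc s" I' Z]] I'(2-)
      by (intro exI[of _ "I'(Suc s := Suc (I' (Suc s)))"]) auto
  qed
  moreover have "index_block A (B ;; [I_Inc (Suc s)])"
    using B by (intro index_block_intros) auto
  ultimately show "\<exists>B. index_block A B \<and> delivers A s B (\<lambda>x. Suc (f x))"
    by blast
qed

lemma cmp_const: "cmp A r (\<lambda>x. c)"
  by (induction c) (auto intro: cmp_0 cmp_Suc)

text \<open>
  The closure condition on the step function \<open>st\<close> plays two roles: with variables for \<open>g\<close> and \<open>h\<close>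
  it provides the code of the loop body, with constants it shows that \<open>st i a\<close> depends on the
  registers up to \<open>r\<close> only.
\<close>

lemma cmp_rec:
  fixes A :: "('c, 'f, 'r, 'u) fo_structure"
  assumes f: "cmp A r f" and b: "cmp A r b"
    and st: "\<And>t g h. r \<le> t \<Longrightarrow> cmp A t g \<Longrightarrow> cmp A t h \<Longrightarrow> cmp A t (\<lambda>x. st (g x) (h x) x)"
  shows "cmp A r (\<lambda>x. rec_nat (b x) (\<lambda>i a. st i a x) (f x))" (is "cmp A r ?F")
  unfolding cmp_def
proof (intro conjI allI impI)
  have st_dep: "st i a x = st i a y" if "\<And>j. 1 \<le> j \<Longrightarrow> j \<le> r \<Longrightarrow> x j = y j" for i a x y
    by (rule determinedD[OF cmp_determined[OF st[OF order.refl cmp_const[of A r i] cmp_const[of A r a]]]])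
      (rule that)
  note f_dep = determinedD[OF cmp_determined[OF f]] and b_dep = determinedD[OF cmp_determined[OF b]]
  show "determined r ?F"
    unfolding determined_def
  proof (intro allI impI)
    fix x y :: "nat \<Rightarrow> nat"
    assume "\<forall>j\<in>{1..r}. x j = y j"
    then have "f x = f y" "b x = b y" "(\<lambda>i a. st i a x) = (\<lambda>i a. st i a y)"
      using f_dep[of x y] b_dep[of x y] st_dep[of x y] by auto
    then show "?F x = ?F y"
      by simp
  qed
  fix s assume s: "r \<le> s"
  \<comment> \<open>With this layout each sub-block drops its result where it is needed:
    \<open>Bf\<close> leaves the number of rounds in \<open>?n\<close>, \<open>Bb\<close> the start
    value in \<open>?a\<close>, and \<open>Bs\<close> the next value in \<open>?v\<close>.\<close>
  let ?n = "Suc s" and ?i = "Suc (Suc s)" and ?a = "Suc (Suc (Suc s))" and ?v = "Suc (Suc (Suc (Suc s)))"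
  obtain Bf where Bf: "index_block A Bf" "delivers A s Bf f"
    using cmpD[OF f s] by blast
  obtain Bb where Bb: "index_block A Bb" "delivers A ?i Bb b"
    using cmpD[OF b, of ?i] s by auto
  have "cmp A ?a (\<lambda>x. st (x ?i) (x ?a) x)"
    using s by (intro st cmp_var) auto
  then obtain Bs where Bs: "index_block A Bs" "delivers A ?a Bs (\<lambda>x. st (x ?i) (x ?a) x)"
    using cmpD by blast
  let ?body = "Bs ;; assign ?a ?v ;; [I_Inc ?i]"
  \<comment> \<open>The counter \<open>?i\<close> is reset only after \<open>Bf\<close>, for which
    it is scratch space; \<open>Bb\<close> preserves it. The last assignment moves the result to
    register \<open>Suc s\<close>, as \<open>delivers\<close> demands.\<close>
  let ?B = "Bf ;; [I_One ?i] ;; Bb ;; loop ?i ?n ?body ;; assign ?n ?a"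
  have "index_block A ?B"
    using Bf Bb Bs by (intro index_block_intros index_block_assign) auto
  moreover have "delivers A s ?B ?F"
    unfolding delivers_def
  proof (intro allI impI)
    fix I :: "nat \<Rightarrow> nat" and Z :: "nat \<Rightarrow> 'u" assume I: "positive I"
    define x where "x = (\<lambda>j. I j - 1)"
    define R where "R n = rec_nat (b x) (\<lambda>i a. st i a x) n" for n
    obtain I1 where I1: "blk A Bf (I, Z) (I1, Z)" "positive I1"
        "\<And>j. 1 \<le> j \<Longrightarrow> j \<le> s \<Longrightarrow> I1 j = I j" "I1 ?n = Suc (f x)"
      unfolding x_def by (rule deliversD[OF Bf(2) I, where Z = Z]) blast
    let ?I2 = "I1(?i := 1)"
    have I2: "blk A [I_One ?i] (I1, Z) (?I2, Z)" "positive ?I2"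
      using I1(2) blk_One by auto
    obtain I3 where I3: "blk A Bb (?I2, Z) (I3, Z)" "positive I3"
        "\<And>j. 1 \<le> j \<Longrightarrow> j \<le> ?i \<Longrightarrow> I3 j = ?I2 j" "I3 ?a = Suc (b (\<lambda>j. ?I2 j - 1))"
      by (rule deliversD[OF Bb(2) I2(2), where Z = Z]) blast
    have bx: "b (\<lambda>j. ?I2 j - 1) = b x"
      using s I1(3) by (intro b_dep) (auto simp: x_def)
    define Inv where "Inv J W \<longleftrightarrow> W = Z \<and> positive J \<and> (\<forall>j. 1 \<le> j \<and> j \<le> s \<longrightarrow> J j = I j) \<and>
        J ?n = Suc (f x) \<and> (\<exists>n\<le>f x. J ?i = Suc n \<and> J ?a = Suc (R n))" for J W
    have "\<exists>I' Z'. blk A (loop ?i ?n ?body) (I3, Z) (I', Z') \<and> Inv I' Z' \<and> I' ?i = I' ?n"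
    proof (rule blk_loop[where m = "\<lambda>J. Suc (f x) - J ?i"])
      show "Inv I3 Z"
        using I3 I1(3,4) bx by (auto simp: Inv_def R_def)
    next
      fix J W assume J: "Inv J W" "J ?i \<noteq> J ?n"
      then obtain n where n: "n < f x" "J ?i = Suc n" "J ?a = Suc (R n)"
        by (auto simp: Inv_def le_less)
      have JI: "positive J" "W = Z" "\<And>j. 1 \<le> j \<Longrightarrow> j \<le> s \<Longrightarrow> J j = I j" "J ?n = Suc (f x)"
        using J(1) by (auto simp: Inv_def)
      obtain J1 where J1: "blk A Bs (J, Z) (J1, Z)" "positive J1"
        "\<And>j. 1 \<le> j \<Longrightarrow> j \<le> ?a \<Longrightarrow> J1 j = J j" "J1 ?v = Suc (st (J ?i - 1) (J ?a - 1) (\<lambda>j. J j - 1))"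
        by (rule deliversD[OF Bs(2) JI(1), where Z = Z]) blast
      have "st n (R n) (\<lambda>j. J j - 1) = st n (R n) x"
        using s JI(3) by (intro st_dep) (auto simp: x_def)
      then have v: "J1 ?v = Suc (R (Suc n))"
        using J1(4) n by (simp add: R_def)
      let ?J2 = "J1(?a := J1 ?v)"
      have J2: "blk A (assign ?a ?v) (J1, Z) (?J2, Z)"
        using v by (intro blk_assign) auto
      let ?J3 = "?J2(?i := Suc (?J2 ?i))"
      have "blk A ?body (J, Z) (?J3, Z)"
        by (intro blk_seqb[OF J1(1)] blk_seqb[OF J2] blk_Inc)
      moreover have "Inv ?J3 Z"
        using JI J1(2,3) n v by (auto simp: Inv_def)
      moreover have "Suc (f x) - ?J3 ?i < Suc (f x) - J ?i"
        using n J1(3) by auto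
      ultimately show "\<exists>I' Z'. blk A ?body (J, W) (I', Z') \<and> Inv I' Z' \<and>
          Suc (f x) - I' ?i < Suc (f x) - J ?i"
        using JI(2) by blast
    qed
    then obtain I4 where I4: "blk A (loop ?i ?n ?body) (I3, Z) (I4, Z)" "Inv I4 Z" "I4 ?i = I4 ?n"
      by (auto simp: Inv_def)
    then have I4a: "I4 ?a = Suc (R (f x))" "positive I4" "\<And>j. 1 \<le> j \<Longrightarrow> j \<le> s \<Longrightarrow> I4 j = I j"
      by (auto simp: Inv_def)
    let ?I5 = "I4(?n := I4 ?a)"
    have "blk A (assign ?n ?a) (I4, Z) (?I5, Z)"
      using I4a by (intro blk_assign) auto
    then have "blk A ?B (I, Z) (?I5, Z)"
      by (intro blk_seqb[OF I1(1)] blk_seqb[OF I2(1)] blk_seqb[OF I3(1)] blk_seqb[OF I4(1)])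
    moreover have "?I5 ?n = Suc (?F (\<lambda>j. I j - 1))"
      using I4a by (simp add: R_def x_def)
    ultimately show "\<exists>I'. blk A ?B (I, Z) (I', Z) \<and> positive I' \<and>
        (\<forall>j\<in>{1..s}. I' j = I j) \<and> I' (Suc s) = Suc (?F (\<lambda>j. I j - 1))"
      using I4a by (intro exI[of _ ?I5]) auto
  qed
  ultimately show "\<exists>B. index_block A B \<and> delivers A s B ?F"
    by blast
qed

text \<open>A solution is demanded for every register content, because \<open>delivers\<close> asks
  for termination from every positive state.\<close>

lemma cmp_Least_0:
  fixes A :: "('c, 'f, 'r, 'u) fo_structure"
  assumes p: "\<And>t g. r \<le> t \<Longrightarrow> cmp A t g \<Longrightarrow> cmp A t (\<lambda>x. p (g x) x)"
    and ex: "\<And>x. \<exists>i. p i x = 0"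
  shows "cmp A r (\<lambda>x. LEAST i. p i x = 0)" (is "cmp A r ?F")
  unfolding cmp_def
proof (intro conjI allI impI)
  have p_dep: "p i x = p i y" if "\<And>j. 1 \<le> j \<Longrightarrow> j \<le> r \<Longrightarrow> x j = y j" for i x y
    by (rule determinedD[OF cmp_determined[OF p[OF order.refl cmp_const[of A r i]]]]) (rule that)
  show "determined r ?F"
    unfolding determined_def
  proof (intro allI impI)
    fix x y :: "nat \<Rightarrow> nat"
    assume "\<forall>j\<in>{1..r}. x j = y j"
    then have "(\<lambda>i. p i x) = (\<lambda>i. p i y)"
      using p_dep[of x y] by auto
    then show "?F x = ?F y"
      by metis
  qed
  fix s assume s: "r \<le> s"
  \<comment> \<open>Register \<open>?o\<close> contains 1, the code of 0, so comparing
    \<open>?v\<close> with \<open>?o\<close> tests for a zero. As \<open>?o\<close> is scratch space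
    for the test block \<open>Bp\<close>, it is set again after each run of
    \<open>Bp\<close>.\<close>
  let ?i = "Suc s" and ?v = "Suc (Suc s)" and ?o = "Suc (Suc (Suc s))"
  have "cmp A ?i (\<lambda>x. p (x ?i) x)"
    using s by (intro p cmp_var) auto
  then obtain Bp where Bp: "index_block A Bp" "delivers A ?i Bp (\<lambda>x. p (x ?i) x)"
    using cmpD by blast
  let ?T = "Bp ;; [I_One ?o]"
  let ?body = "[I_Inc ?i] ;; ?T"
  let ?B = "[I_One ?i] ;; ?T ;; loop ?v ?o ?body"
  have "index_block A ?B"
    using Bp by (intro index_block_intros) auto
  moreover have "delivers A s ?B ?F"
    unfolding delivers_def
  proof (intro allI impI)
    fix I :: "nat \<Rightarrow> nat" and Z :: "nat \<Rightarrow> 'u" assume I: "positive I"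
    define x where "x = (\<lambda>j. I j - 1)"
    define N where "N = (LEAST i. p i x = 0)"
    have N: "p N x = 0"
      unfolding N_def using ex[of x] by (rule LeastI_ex)
    define Inv where "Inv J W \<longleftrightarrow> W = Z \<and> positive J \<and> (\<forall>j. 1 \<le> j \<and> j \<le> s \<longrightarrow> J j = I j) \<and>
        J ?o = 1 \<and> (\<exists>n\<le>N. J ?i = Suc n \<and> J ?v = Suc (p n x))" for J W
    have T: "\<exists>J'. blk A ?T (J, Z) (J', Z) \<and> Inv J' Z \<and> J' ?i = J ?i"
      if J: "positive J" "\<And>j. 1 \<le> j \<Longrightarrow> j \<le> s \<Longrightarrow> J j = I j" "J ?i = Suc n" "n \<le> N" for J n
    proof -
      obtain J1 where J1: "blk A Bp (J, Z) (J1, Z)" "positive J1"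
        "\<And>j. 1 \<le> j \<Longrightarrow> j \<le> ?i \<Longrightarrow> J1 j = J j" "J1 ?v = Suc (p (J ?i - 1) (\<lambda>j. J j - 1))"
        by (rule deliversD[OF Bp(2) J(1), where Z = Z]) blast
      have "p n (\<lambda>j. J j - 1) = p n x"
        using s J(2) by (intro p_dep) (auto simp: x_def)
      then have "J1 ?v = Suc (p n x)"
        using J1 J by simp
      then have "Inv (J1(?o := 1)) Z"
        using J J1(2,3) by (auto simp: Inv_def)
      moreover have "blk A ?T (J, Z) (J1(?o := 1), Z)"
        by (intro blk_seqb[OF J1(1)] blk_One)
      ultimately show ?thesis
        using J1(3)[of ?i] by (intro exI[of _ "J1(?o := 1)"]) auto
    qed
    obtain I1 where I1: "blk A ?T (I(?i := 1), Z) (I1, Z)" "Inv I1 Z"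
      using T[of "I(?i := 1)" 0] I by auto
    have "\<exists>I' Z'. blk A (loop ?v ?o ?body) (I1, Z) (I', Z') \<and> Inv I' Z' \<and> I' ?v = I' ?o"
    proof (rule blk_loop[where m = "\<lambda>J. Suc N - J ?i"])
      show "Inv I1 Z"
        by (rule I1(2))
      fix J W assume J: "Inv J W" "J ?v \<noteq> J ?o"
      then obtain n where n: "n \<le> N" "J ?i = Suc n" "J ?v = Suc (p n x)" "W = Z"
        by (auto simp: Inv_def)
      \<comment> \<open>At \<open>N\<close> register \<open>?v\<close> would contain 1 just like
        \<open>?o\<close>, against the loop test; so the search cannot run past \<open>N\<close>,
        and \<open>Suc N - J ?i\<close> is a variant.\<close>
      then have "n < N"
        using J N by (cases "n = N") (auto simp: Inv_def)
      then obtain J' where J': "blk A ?T (J(?i := Suc (J ?i)), Z) (J', Z)" "Inv J' Z"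
          "J' ?i = Suc (Suc n)"
        using T[of "J(?i := Suc (J ?i))" "Suc n"] J n by (auto simp: Inv_def)
      have "blk A ?body (J, Z) (J', Z)"
        by (intro blk_seqb[OF blk_Inc J'(1)])
      then show "\<exists>I' Z'. blk A ?body (J, W) (I', Z') \<and> Inv I' Z' \<and> Suc N - I' ?i < Suc N - J ?i"
        using J' n \<open>n < N\<close> by (intro exI[of _ J'] exI[of _ Z]) auto
    qed
    then obtain I2 where I2: "blk A (loop ?v ?o ?body) (I1, Z) (I2, Z)" "Inv I2 Z" "I2 ?v = I2 ?o"
      by (auto simp: Inv_def)
    then obtain n where n: "n \<le> N" "I2 ?i = Suc n" "p n x = 0"
      by (auto simp: Inv_def)
    then have "n = N"
      unfolding N_def by (simp add: Least_le le_antisym)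
    moreover have "blk A ?B (I, Z) (I2, Z)"
      by (intro blk_seqb[OF blk_One] blk_seqb[OF I1(1) I2(1)])
    ultimately show "\<exists>I'. blk A ?B (I, Z) (I', Z) \<and> positive I' \<and>
        (\<forall>j\<in>{1..s}. I' j = I j) \<and> I' (Suc s) = Suc (?F (\<lambda>j. I j - 1))"
      using I2 n by (intro exI[of _ I2]) (auto simp: Inv_def N_def x_def)
  qed
  ultimately show "\<exists>B. index_block A B \<and> delivers A s B ?F"
    by blast
qed

section \<open>Arithmetic by primitive recursion\<close>

lemma cmp_add: assumes f: "cmp A r f" and g: "cmp A r g" shows "cmp A r (\<lambda>x. f x + g x)"
proof -
  have "rec_nat a (\<lambda>i. Suc) n = a + n" for a n
    by (induction n) auto
  moreover have "cmp A r (\<lambda>x. rec_nat (f x) (\<lambda>i a. Suc a) (g x))"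
    by (intro cmp_rec cmp_Suc f g)
  ultimately show ?thesis
    by simp
qed

lemma cmp_pred: assumes f: "cmp A r f" shows "cmp A r (\<lambda>x. f x - 1)"
proof -
  have "rec_nat 0 (\<lambda>i a. i) n = n - 1" for n
    by (cases n) auto
  moreover have "cmp A r (\<lambda>x. rec_nat 0 (\<lambda>i a. i) (f x))"
    by (intro cmp_rec cmp_const f)
  ultimately show ?thesis
    by simp
qed

lemma cmp_diff: assumes f: "cmp A r f" and g: "cmp A r g" shows "cmp A r (\<lambda>x. f x - g x)"
proof -
  have "rec_nat a (\<lambda>i b. b - 1) n = a - n" for a n :: nat
    by (induction n) auto
  moreover have "cmp A r (\<lambda>x. rec_nat (f x) (\<lambda>i a. a - 1) (g x))"
    by (intro cmp_rec cmp_pred f g)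
  ultimately show ?thesis
    by simp
qed

lemma cmp_mult: assumes f: "cmp A r f" and g: "cmp A r g" shows "cmp A r (\<lambda>x. f x * g x)"
proof -
  have "rec_nat 0 (\<lambda>i b. b + a) n = a * n" for a n :: nat
    by (induction n) auto
  moreover have "cmp A r (\<lambda>x. rec_nat 0 (\<lambda>i a. a + f x) (g x))"
    by (intro cmp_rec cmp_add cmp_const f[THEN cmp_mono] g)
  ultimately show ?thesis
    by simp
qed

lemma cmp_power: assumes f: "cmp A r f" and g: "cmp A r g" shows "cmp A r (\<lambda>x. f x ^ g x)"
proof -
  have "rec_nat 1 (\<lambda>i b. a * b) n = a ^ n" for a n :: nat
    by (induction n) auto
  moreover have "cmp A r (\<lambda>x. rec_nat 1 (\<lambda>i a. f x * a) (g x))"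
    by (intro cmp_rec cmp_mult cmp_const f[THEN cmp_mono] g)
  ultimately show ?thesis
    by simp
qed

text \<open>The summation index is not tied to a register: the summand has to be computable for
  every computable \<open>g\<close> in its place. Nested binders then need no bookkeeping of
  registers beyond raising the bound \<open>t\<close>.\<close>

lemma cmp_sum:
  assumes f: "cmp A r f"
    and s: "\<And>t g. r \<le> t \<Longrightarrow> cmp A t g \<Longrightarrow> cmp A t (\<lambda>x. s (g x) x)"
  shows "cmp A r (\<lambda>x. \<Sum>i<f x. s i x)"
proof -
  have "rec_nat 0 (\<lambda>i a. a + s i x) n = (\<Sum>i<n. s i x)" for n x
    by (induction n) auto
  moreover have "cmp A r (\<lambda>x. rec_nat 0 (\<lambda>i a. a + s i x) (f x))"
    by (intro cmp_rec cmp_add cmp_const f s)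
  ultimately show ?thesis
    by simp
qed

lemma cmp_prod:
  assumes f: "cmp A r f"
    and s: "\<And>t g. r \<le> t \<Longrightarrow> cmp A t g \<Longrightarrow> cmp A t (\<lambda>x. s (g x) x)"
  shows "cmp A r (\<lambda>x. \<Prod>i<f x. s i x)"
proof -
  have "rec_nat 1 (\<lambda>i a. a * s i x) n = (\<Prod>i<n. s i x)" for n x
    by (induction n) auto
  moreover have "cmp A r (\<lambda>x. rec_nat 1 (\<lambda>i a. a * s i x) (f x))"
    by (intro cmp_rec cmp_mult cmp_const f s)
  ultimately show ?thesis
    by simp
qed

section \<open>Decidable predicates, bounded quantifiers and search\<close>

definition dec :: "('c, 'f, 'r, 'u) fo_structure \<Rightarrow> nat \<Rightarrow> ((nat \<Rightarrow> nat) \<Rightarrow> bool) \<Rightarrow> bool" where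
  "dec A r p \<longleftrightarrow> cmp A r (\<lambda>x. of_bool (p x))"

lemma cmp_of_bool: "dec A r p \<Longrightarrow> cmp A r (\<lambda>x. of_bool (p x))"
  by (simp add: dec_def)

text \<open>The truth value serves as the number of rounds of a recursion: no round leaves the start
  value \<open>g x\<close>, one round replaces it by \<open>f x\<close>.\<close>

lemma cmp_if:
  assumes p: "dec A r p" and f: "cmp A r f" and g: "cmp A r g"
  shows "cmp A r (\<lambda>x. if p x then f x else g x)"
proof -
  have "rec_nat b (\<lambda>i _. a) (of_bool q) = (if q then a else b)" for a b :: nat and q
    by auto
  moreover have "cmp A r (\<lambda>x. rec_nat (g x) (\<lambda>i _. f x) (of_bool (p x)))"
    by (intro cmp_rec f[THEN cmp_mono] g p[unfolded dec_def])
  ultimately show ?thesis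
    by simp
qed

lemma dec_eq_0: assumes f: "cmp A r f" shows "dec A r (\<lambda>x. f x = 0)"
proof -
  have "rec_nat 1 (\<lambda>i _. 0) n = (of_bool (n = 0) :: nat)" for n
    by (cases n) auto
  moreover have "cmp A r (\<lambda>x. rec_nat 1 (\<lambda>i _. 0) (f x))"
    by (intro cmp_rec f cmp_const)
  ultimately show ?thesis
    by (simp add: dec_def)
qed

lemma dec_not: assumes "dec A r p" shows "dec A r (\<lambda>x. \<not> p x)"
  using dec_eq_0[OF assms[unfolded dec_def]] by simp

lemma dec_conj: assumes "dec A r p" "dec A r q" shows "dec A r (\<lambda>x. p x \<and> q x)"
  using cmp_mult[OF assms[unfolded dec_def]] by (simp add: dec_def of_bool_conj)

lemma dec_disj: assumes "dec A r p" "dec A r q" shows "dec A r (\<lambda>x. p x \<or> q x)"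
proof -
  have "dec A r (\<lambda>x. \<not> (\<not> p x \<and> \<not> q x))"
    by (rule dec_not dec_conj assms)+
  then show ?thesis
    by simp
qed

lemma dec_imp: assumes "dec A r p" "dec A r q" shows "dec A r (\<lambda>x. p x \<longrightarrow> q x)"
  unfolding imp_conv_disj by (rule dec_disj dec_not assms)+

lemma dec_le: assumes "cmp A r f" "cmp A r g" shows "dec A r (\<lambda>x. f x \<le> g x)"
  using dec_eq_0[OF cmp_diff[OF assms]] by simp

lemma dec_less: assumes "cmp A r f" "cmp A r g" shows "dec A r (\<lambda>x. f x < g x)"
  using dec_le[OF cmp_Suc[OF assms(1)] assms(2)] by (simp add: Suc_le_eq)

lemma dec_eq: assumes "cmp A r f" "cmp A r g" shows "dec A r (\<lambda>x. f x = g x)"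
  using dec_conj[OF dec_le[OF assms] dec_le[OF assms(2,1)]] by (simp flip: order.eq_iff)

lemma dec_all:
  assumes f: "cmp A r f"
    and p: "\<And>t g. r \<le> t \<Longrightarrow> cmp A t g \<Longrightarrow> dec A t (\<lambda>x. p (g x) x)"
  shows "dec A r (\<lambda>x. \<forall>i<f x. p i x)"
proof -
  have "(\<Prod>i<n. of_bool (p i x)) = (of_bool (\<forall>i<n. p i x) :: nat)" for n x
    by (induction n) (auto simp: less_Suc_eq)
  moreover have "cmp A r (\<lambda>x. \<Prod>i<f x. of_bool (p i x))"
    by (intro cmp_prod f p[unfolded dec_def])
  ultimately show ?thesis
    by (simp add: dec_def)
qed

lemma dec_ex:
  assumes f: "cmp A r f"
    and p: "\<And>t g. r \<le> t \<Longrightarrow> cmp A t g \<Longrightarrow> dec A t (\<lambda>x. p (g x) x)"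
  shows "dec A r (\<lambda>x. \<exists>i<f x. p i x)"
proof -
  have "dec A r (\<lambda>x. \<not> (\<forall>i<f x. \<not> p i x))"
    by (intro dec_not dec_all f p)
  then show ?thesis
    by simp
qed

lemma cmp_Least:
  assumes p: "\<And>t g. r \<le> t \<Longrightarrow> cmp A t g \<Longrightarrow> dec A t (\<lambda>x. p (g x) x)"
    and ex: "\<And>x. \<exists>i. p i x"
  shows "cmp A r (\<lambda>x. LEAST i. p i x)"
proof -
  have "cmp A r (\<lambda>x. LEAST i. of_bool (\<not> p i x) = (0::nat))"
  proof (rule cmp_Least_0)
    show "cmp A t (\<lambda>x. of_bool (\<not> p (g x) x))" if "r \<le> t" "cmp A t g" for t g
      using dec_not[OF p[OF that]] by (simp only: dec_def)
    show "\<exists>i. of_bool (\<not> p i x) = (0::nat)" for x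
      using ex by simp
  qed
  then show ?thesis
    by simp
qed

text \<open>Here \<open>h\<close> is arbitrary: only its values below the constant \<open>N\<close>
  matter, and each of them is compiled in as a constant. In this way the jumps of the fixed program
  \<open>P\<close> enter the code.\<close>

lemma cmp_table:
  assumes f: "cmp A r f"
  shows "cmp A r (\<lambda>x. if f x < N then h (f x) else 0)"
proof (induction N)
  case 0
  then show ?case
    by (simp add: cmp_const)
next
  case (Suc N)
  have "cmp A r (\<lambda>x. if f x = N then h N else if f x < N then h (f x) else 0)"
    by (intro cmp_if dec_eq cmp_const f Suc)
  moreover have "(\<lambda>x. if f x = N then h N else if f x < N then h (f x) else 0) =
      (\<lambda>x. if f x < Suc N then h (f x) else 0)"
    by (auto simp: less_Suc_eq)
  ultimately show ?case
    by simp
qed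

lemma dec_dvd: assumes f: "cmp A r f" and g: "cmp A r g" shows "dec A r (\<lambda>x. f x dvd g x)"
proof -
  have "dec A r (\<lambda>x. \<exists>k<Suc (g x). g x = f x * k)"
    by (intro dec_ex dec_eq cmp_mult cmp_Suc f[THEN cmp_mono] g[THEN cmp_mono] order.refl)
  \<comment> \<open>A quotient of \<open>b\<close> by a positive \<open>a\<close> never exceeds
    \<open>b\<close>; for \<open>a = 0\<close> divisibility forces \<open>b = 0\<close>, where
    \<open>k = 0\<close> will do.\<close>
  moreover have "a dvd b \<longleftrightarrow> (\<exists>k<Suc b. b = a * k)" for a b :: nat
    by (cases "a = 0") (auto simp: less_Suc_eq_le elim!: dvdE)
  ultimately show ?thesis
    by simp
qed

lemma dec_prime: assumes f: "cmp A r f" shows "dec A r (\<lambda>x. prime (f x))"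
proof -
  have "dec A r (\<lambda>x. 1 < f x \<and> (\<forall>d<f x. d dvd f x \<longrightarrow> d = 1))"
    by (intro dec_conj dec_less dec_all dec_imp dec_dvd dec_eq cmp_const f[THEN cmp_mono] order.refl)
  moreover have "prime n \<longleftrightarrow> 1 < n \<and> (\<forall>d<n. d dvd n \<longrightarrow> d = 1)" for n :: nat
  proof
    assume "prime n"
    then show "1 < n \<and> (\<forall>d<n. d dvd n \<longrightarrow> d = 1)"
      unfolding prime_nat_iff by blast
  next
    assume n: "1 < n \<and> (\<forall>d<n. d dvd n \<longrightarrow> d = 1)"
    then have "d \<le> n" if "d dvd n" for d
      using that by (intro dvd_imp_le) auto
    then show "prime n"
      unfolding prime_nat_iff using n le_neq_implies_less by blast
  qed
  ultimately show ?thesis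
    by simp
qed

lemmas dec_cmp_intros =
  cmp_const cmp_add cmp_diff cmp_mult cmp_power cmp_sum cmp_prod cmp_if cmp_Suc cmp_of_bool
  dec_not dec_conj dec_disj dec_imp dec_le dec_less dec_eq dec_all dec_ex dec_dvd dec_prime

section \<open>The order of the paths\<close>

lemma path_le_refl: "path_le ks ks"
  by (simp add: path_le_def)

lemma path_le_trans: "path_le ks ls \<Longrightarrow> path_le ls ms \<Longrightarrow> path_le ks ms"
  unfolding path_le_def using lenlex_trans[OF _ _ trans_less_than] by metis

lemma path_le_antisym:
  assumes "path_le ks ls" "path_le ls ks"
  shows "ks = ls"
proof (rule ccontr)
  assume "ks \<noteq> ls"
  then have "(ks, ks) \<in> lenlex less_than"
    using assms lenlex_trans[OF _ _ trans_less_than] unfolding path_le_def by metis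
  then show False
    using lenlex_irreflexive[of less_than ks] by simp
qed

lemma path_le_linear: "path_le ks ls \<or> path_le ls ks"
  using total_lenlex[OF total_less_than] unfolding path_le_def total_on_def by blast

lemma path_le_length: "path_le ks ls \<Longrightarrow> length ks \<le> length ls"
  unfolding path_le_def using lenlex_length by auto

text \<open>Naming the position of the first difference leaves only quantifiers bounded by
  positions, which is the form that the closure rules accept.\<close>

lemma lex_less_than_iff:
  "(xs, ys) \<in> lex less_than \<longleftrightarrow>
     length xs = length ys \<and> (\<exists>i<length xs. (\<forall>j<i. xs ! j = ys ! j) \<and> xs ! i < ys ! i)"
proof
  assume xy: "(xs, ys) \<in> lex less_than"
  then obtain i where i: "i < length xs" "i < length ys" "take i xs = take i ys" "xs ! i < ys ! i"
    by (elim lex_take_index) simp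
  have "xs ! j = ys ! j" if "j < i" for j
    using nth_take[OF that, of xs] nth_take[OF that, of ys] i(3) by simp
  moreover have "length xs = length ys"
    using xy by (simp add: lex_conv)
  ultimately show "length xs = length ys \<and> (\<exists>i<length xs. (\<forall>j<i. xs ! j = ys ! j) \<and> xs ! i < ys ! i)"
    using i by blast
next
  assume "length xs = length ys \<and> (\<exists>i<length xs. (\<forall>j<i. xs ! j = ys ! j) \<and> xs ! i < ys ! i)"
  then obtain i where i: "length xs = length ys" "i < length xs" "\<forall>j<i. xs ! j = ys ! j" "xs ! i < ys ! i"
    by blast
  then have "take i xs = take i ys"
    by (intro nth_equalityI) auto
  then have "xs = take i xs @ xs ! i # drop (Suc i) xs" "ys = take i xs @ ys ! i # drop (Suc i) ys"
    using i id_take_nth_drop[of i xs] id_take_nth_drop[of i ys] by auto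
  then show "(xs, ys) \<in> lex less_than"
    using i(1,4) unfolding lex_conv by force
qed

section \<open>Existence and uniqueness of ranks\<close>

definition rank :: "nat list set \<Rightarrow> nat list \<Rightarrow> nat" where
  "rank S ls = card {ks \<in> S. path_le ks ls}"

text \<open>A downward closed set of \<open>n\<close> elements is grown by one element at a time.
  The remainder has a minimal element \<open>m\<close> because \<open>lenlex less_than\<close> is
  well-founded, and by linearity the enlarged set consists of exactly the elements up to
  \<open>m\<close>.\<close>

lemma ex_rank:
  assumes "1 \<le> n" "infinite S \<or> n \<le> card S"
  shows "\<exists>ls\<in>S. rank S ls = n"
proof -
  have "\<exists>T. T \<subseteq> S \<and> finite T \<and> card T = n \<and> (\<forall>ls\<in>T. \<forall>ks\<in>S. path_le ks ls \<longrightarrow> ks \<in> T) \<and>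
      (1 \<le> n \<longrightarrow> (\<exists>m\<in>S. T = {ks \<in> S. path_le ks m}))"
    using assms(2)
  proof (induction n)
    case 0
    show ?case
      by (rule exI[of _ "{}"]) simp
  next
    case (Suc n)
    then have "infinite S \<or> n \<le> card S"
      by auto
    with Suc.IH obtain T where T: "T \<subseteq> S" "finite T" "card T = n"
      "\<And>ls ks. ls \<in> T \<Longrightarrow> ks \<in> S \<Longrightarrow> path_le ks ls \<Longrightarrow> ks \<in> T"
      by blast
    have "S - T \<noteq> {}"
      using Suc.prems T(1-3) by auto
    then obtain m where m: "m \<in> S - T" "\<And>ks. (ks, m) \<in> lenlex less_than \<Longrightarrow> ks \<notin> S - T"
      using wfE_min[OF wf_lenlex[OF wf_less_than], of _ "S - T"] by blast
    have "ks \<in> insert m T \<longleftrightarrow> path_le ks m" if "ks \<in> S" for ks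
      using that T(4)[of ks m] m path_le_linear[of ks m] by (auto simp: path_le_def)
    then have eq: "insert m T = {ks \<in> S. path_le ks m}"
      using T(1) m(1) by auto
    have "\<forall>ls\<in>insert m T. \<forall>ks\<in>S. path_le ks ls \<longrightarrow> ks \<in> insert m T"
      unfolding eq using path_le_trans by blast
    moreover have "insert m T \<subseteq> S" "finite (insert m T)" "card (insert m T) = Suc n"
      using T(1-3) m(1) by auto
    ultimately show ?case
      using m(1) eq by blast
  qed
  then show ?thesis
    using assms(1) by (auto simp: rank_def)
qed

text \<open>Initial segments of two elements are nested; if they are finite and equally large they
  coincide, so each element lies below the other. Finiteness matters, since \<open>card\<close> is 0
  on every infinite set.\<close>

lemma rank_inj:
  assumes "\<And>ls. ls \<in> S \<Longrightarrow> finite {ks \<in> S. path_le ks ls}" "ks \<in> S" "ls \<in> S" "rank S ks = rank S ls"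
  shows "ks = ls"
proof -
  have "ks = ls" if "ks \<in> S" "ls \<in> S" "path_le ks ls" "rank S ks = rank S ls" for ks ls
  proof -
    have "{ms \<in> S. path_le ms ks} \<subseteq> {ms \<in> S. path_le ms ls}"
      using that(3) path_le_trans by blast
    then have "{ms \<in> S. path_le ms ks} = {ms \<in> S. path_le ms ls}"
      using that(4) assms(1)[OF that(2)] unfolding rank_def by (intro card_subset_eq) auto
    then have "path_le ls ks"
      using that(2) path_le_refl by blast
    then show ?thesis
      using that(3) path_le_antisym by blast
  qed
  from this[of ks ls] this[of ls ks] show ?thesis
    using assms(2-4) path_le_linear[of ks ls] by auto
qed

text \<open>This is where comparing lengths first counts: over the finite alphabet
  \<open>labels P\<close> there are finitely many words of bounded length, whereas a purely
  lexicographic order can have infinitely many predecessors.\<close>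

lemma finite_fin_paths_below: "finite {ks \<in> fin_paths P. path_le ks ls}"
proof (rule finite_subset)
  show "{ks \<in> fin_paths P. path_le ks ls} \<subseteq> {ks. set ks \<subseteq> labels P \<and> length ks \<le> length ls}"
    using path_le_length by (auto simp: fin_paths_def)
  show "finite {ks. set ks \<subseteq> labels P \<and> length ks \<le> length ls}"
    by (rule finite_lists_length_le) (simp add: labels_def)
qed

lemmas rank_fin_paths_inj = rank_inj[OF finite_fin_paths_below]

definition capped :: "('c, 'f, 'r) program \<Rightarrow> nat \<Rightarrow> nat" where
  "capped P n = (if infinite (fin_paths P) then n else min n (card (fin_paths P)))"

lemma nth_path_rank: "ls \<in> fin_paths P \<Longrightarrow> nth_path P (rank (fin_paths P) ls) = ls"
  unfolding nth_path_def using rank_fin_paths_inj by (auto simp: rank_def intro!: the_equality)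

lemma enum_O_capped: "enum_O P n = nth_path P (capped P n)"
  by (simp add: enum_O_def capped_def)

lemma enum_O_fin_paths:
  assumes "fin_paths P \<noteq> {}" "1 \<le> n"
  shows "enum_O P n \<in> fin_paths P" "rank (fin_paths P) (enum_O P n) = capped P n"
proof -
  have "finite (fin_paths P) \<Longrightarrow> card (fin_paths P) \<ge> 1"
    using assms(1) by (simp add: Suc_le_eq card_gt_0_iff)
  then have "\<exists>ls\<in>fin_paths P. rank (fin_paths P) ls = capped P n"
    using assms(2) by (intro ex_rank) (auto simp: capped_def)
  then obtain ls where ls: "ls \<in> fin_paths P" "rank (fin_paths P) ls = capped P n"
    by blast
  then have "enum_O P n = ls"
    using nth_path_rank[OF ls(1)] by (simp add: enum_O_capped)
  then show "enum_O P n \<in> fin_paths P" "rank (fin_paths P) (enum_O P n) = capped P n"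
    using ls by auto
qed

lemma enum_O_image:
  assumes "fin_paths P \<noteq> {}"
  shows "enum_O P ` {1..} = fin_paths P"
proof
  show "enum_O P ` {1..} \<subseteq> fin_paths P"
    using enum_O_fin_paths(1)[OF assms] by auto
  show "fin_paths P \<subseteq> enum_O P ` {1..}"
  proof
    fix ls assume ls: "ls \<in> fin_paths P"
    let ?r = "rank (fin_paths P) ls"
    have "finite (fin_paths P) \<Longrightarrow> ?r \<le> card (fin_paths P)"
      unfolding rank_def by (intro card_mono) auto
    then have "enum_O P ?r = ls"
      using nth_path_rank[OF ls] by (simp add: enum_O_capped capped_def min_def)
    moreover have "?r \<ge> 1"
      unfolding rank_def Suc_le_eq One_nat_def card_gt_0_iff
      using ls finite_fin_paths_below path_le_refl by auto
    ultimately show "ls \<in> enum_O P ` {1..}"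
      by force
  qed
qed

section \<open>Goedel numbers\<close>

abbreviation pr :: "nat \<Rightarrow> nat" where
  "pr \<equiv> enumerate {p. prime p}"

lemma prime_pr: "prime (pr i)"
  using enumerate_in_set[OF primes_infinite] by blast

lemma pr_pos [simp]: "0 < pr i" and pr_neq_0 [simp]: "pr i \<noteq> 0"
  using prime_gt_0_nat[OF prime_pr[of i]] by auto

lemma pr_eq_iff: "pr i = pr j \<longleftrightarrow> i = j"
  using enumerate_mono_iff[OF primes_infinite] by (metis less_irrefl nat_neq_iff)

lemma multiplicity_pr_power: "multiplicity (pr i) (pr j ^ k) = (if i = j then k else 0)"
  using multiplicity_distinct_prime_power[OF prime_pr prime_pr, of i j k] prime_pr[of j]
  by (auto simp: pr_eq_iff multiplicity_same_power prime_gt_0_nat not_prime_unit)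

lemma goedel_pos: "goedel ls > 0"
  unfolding goedel_def by (auto intro!: prod_pos)

lemma multiplicity_goedel: "multiplicity (pr i) (goedel ls) = (if i < length ls then ls ! i else 0)"
proof -
  have "multiplicity (pr i) (goedel ls) = (\<Sum>j<length ls. multiplicity (pr i) (pr j ^ (ls ! j)))"
    unfolding goedel_def using prime_pr[of i]
    by (intro prime_elem_multiplicity_prod_distrib) auto
  also have "\<dots> = (if i < length ls then ls ! i else 0)"
    by (simp add: multiplicity_pr_power)
  finally show ?thesis .
qed

lemma power_dvd_goedel: "pr i ^ k dvd goedel ls \<longleftrightarrow> k \<le> (if i < length ls then ls ! i else 0)"
  using prime_pr[of i] goedel_pos[of ls]
  by (subst power_dvd_iff_le_multiplicity) (auto simp: multiplicity_goedel not_prime_unit)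

text \<open>The alternative \<open>g = 0\<close> makes both searches total.\<close>

definition expo :: "nat \<Rightarrow> nat \<Rightarrow> nat" where
  "expo g i = (LEAST k. \<not> pr i ^ Suc k dvd g \<or> g = 0)"

definition code_length :: "nat \<Rightarrow> nat" where
  "code_length g = (LEAST i. \<not> pr i dvd g \<or> g = 0)"

definition word :: "nat \<Rightarrow> nat list" where
  "word g = map (expo g) [0..<code_length g]"

lemma length_word [simp]: "length (word g) = code_length g"
  by (simp add: word_def)

lemma nth_word [simp]: "i < code_length g \<Longrightarrow> word g ! i = expo g i"
  by (simp add: word_def)

lemma expo_goedel: "expo (goedel ls) i = (if i < length ls then ls ! i else 0)"
  unfolding expo_def power_dvd_goedel using goedel_pos[of ls] by (intro Least_equality) auto

text \<open>An entry 0 would leave its prime out of the product and could end the decoding too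
  early. Labels start at 1, so paths are safe.\<close>

lemma code_length_goedel:
  assumes "0 \<notin> set ls"
  shows "code_length (goedel ls) = length ls"
proof -
  have "pr i dvd goedel ls \<longleftrightarrow> i < length ls" for i
    using power_dvd_goedel[of i 1 ls] assms by (auto simp: Suc_le_eq in_set_conv_nth)
  then show ?thesis
    unfolding code_length_def using goedel_pos[of ls] by (intro Least_equality) auto
qed

lemma word_goedel: "0 \<notin> set ls \<Longrightarrow> word (goedel ls) = ls"
  by (intro nth_equalityI) (simp_all add: code_length_goedel expo_goedel)

lemma fin_paths_pos: "ls \<in> fin_paths P \<Longrightarrow> 0 \<notin> set ls"
  by (auto simp: fin_paths_def labels_def)

text \<open>Decoding stops at the first prime that does not divide \<open>g\<close>, so prime
  factors after a gap go unnoticed by \<open>word\<close>. Encoding the word again excludes such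
  numbers.\<close>

definition is_code :: "('c, 'f, 'r) program \<Rightarrow> nat \<Rightarrow> bool" where
  "is_code P g \<longleftrightarrow> word g \<in> fin_paths P \<and> goedel (word g) = g"

lemma is_code_iff: "is_code P g \<longleftrightarrow> g \<in> goedel ` fin_paths P"
proof
  show "is_code P g \<Longrightarrow> g \<in> goedel ` fin_paths P"
    unfolding is_code_def by (metis imageI)
  assume "g \<in> goedel ` fin_paths P"
  then obtain ls where "ls \<in> fin_paths P" "g = goedel ls"
    by blast
  then show "is_code P g"
    using word_goedel[OF fin_paths_pos, of ls P] by (simp add: is_code_def)
qed

lemma goedel_inj_on: "inj_on goedel (fin_paths P)"
  using word_goedel[OF fin_paths_pos] by (rule inj_on_inverseI)

lemma goedel_le_power:
  assumes "ks \<in> fin_paths P" "ls \<in> fin_paths P" "length ks \<le> length ls"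
  shows "goedel ks \<le> goedel ls ^ stop_label P"
proof -
  have "goedel ks \<le> (\<Prod>i<length ks. (pr i ^ (ls ! i)) ^ stop_label P)"
    unfolding goedel_def
  proof (intro prod_mono conjI)
    fix i assume i: "i \<in> {..<length ks}"
    then have "ks ! i \<in> labels P" "ls ! i \<in> labels P"
      using assms by (auto simp: fin_paths_def)
    then have "ks ! i \<le> ls ! i * stop_label P"
      using mult_le_mono[of 1 "ls ! i" "ks ! i" "stop_label P"] by (auto simp: labels_def)
    then show "pr i ^ (ks ! i) \<le> (pr i ^ (ls ! i)) ^ stop_label P"
      by (simp add: power_increasing Suc_le_eq flip: power_mult)
  qed simp
  also have "\<dots> \<le> (\<Prod>i<length ls. (pr i ^ (ls ! i)) ^ stop_label P)"
    using assms(3) by (intro dvd_imp_le prod_dvd_prod_subset prod_pos) auto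
  finally show ?thesis
    by (simp add: goedel_def prod_power_distrib)
qed

definition code_rank :: "('c, 'f, 'r) program \<Rightarrow> nat \<Rightarrow> nat" where
  "code_rank P g = (\<Sum>h<Suc (g ^ stop_label P). of_bool (is_code P h \<and> path_le (word h) (word g)))"

text \<open>By \<open>goedel_le_power\<close> no predecessor of \<open>ls\<close> has a code beyond
  the bound, and \<open>goedel\<close> is injective on paths; so counting codes amounts to counting
  paths.\<close>

lemma code_rank_goedel:
  assumes "ls \<in> fin_paths P"
  shows "code_rank P (goedel ls) = rank (fin_paths P) ls"
proof -
  let ?K = "{ks \<in> fin_paths P. path_le ks ls}"
  have "{..<Suc (goedel ls ^ stop_label P)} \<inter> {h. is_code P h \<and> path_le (word h) (word (goedel ls))}
      = goedel ` ?K"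
    using goedel_le_power[OF _ assms path_le_length] word_goedel[OF fin_paths_pos, of _ P] assms
    by (auto simp: is_code_iff less_Suc_eq_le)
  moreover have "card (goedel ` ?K) = card ?K"
    by (rule card_image, rule inj_on_subset[OF goedel_inj_on[of P]]) auto
  ultimately show ?thesis
    unfolding code_rank_def rank_def by (simp only: sum_of_bool_eq finite_lessThan of_nat_id)
qed

text \<open>The solution is unique, as the rank determines the path and the path its code.
  \<open>LEAST\<close> therefore only turns a definite description into a search, and the second
  claim says that this search ends.\<close>

lemma goedel_enum_O:
  assumes "fin_paths P \<noteq> {}" "1 \<le> n"
  shows "goedel (enum_O P n) = (LEAST g. is_code P g \<and> code_rank P g = capped P n)" (is "?g = ?l")
    and "\<exists>g. is_code P g \<and> code_rank P g = capped P n"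
proof -
  note e = enum_O_fin_paths[OF assms]
  have g: "is_code P ?g \<and> code_rank P ?g = capped P n"
    using e by (simp add: is_code_iff code_rank_goedel)
  then show "\<exists>g. is_code P g \<and> code_rank P g = capped P n"
    by blast
  have "h = ?g" if h: "is_code P h" "code_rank P h = capped P n" for h
  proof -
    obtain ls where ls: "ls \<in> fin_paths P" "h = goedel ls"
      using h(1) by (auto simp: is_code_iff)
    then have "rank (fin_paths P) ls = rank (fin_paths P) (enum_O P n)"
      using h(2) e(2) by (simp add: code_rank_goedel)
    then show ?thesis
      using rank_fin_paths_inj[OF ls(1) e(1)] ls(2) by simp
  qed
  then show "?g = ?l"
    using g by (intro Least_equality[symmetric]) auto
qed

section \<open>Computing the enumeration\<close>

text \<open>Each prime is the least one above its predecessor, so the enumeration is a recursion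
  whose step is a search; that search is total by Euclid's theorem.\<close>

lemma pr_eq_rec: "pr n = rec_nat 2 (\<lambda>i a. LEAST p. prime p \<and> a < p) n"
proof (induction n)
  case 0
  then show ?case
    by (auto simp: enumerate_0 intro!: Least_equality prime_ge_2_nat)
next
  case (Suc n)
  then show ?case
    by (simp add: enumerate_Suc''[OF primes_infinite])
qed

lemma cmp_pr:
  assumes f: "cmp A r f"
  shows "cmp A r (\<lambda>x. pr (f x))"
  unfolding pr_eq_rec
proof (rule cmp_rec[OF f cmp_const])
  fix t g h
  assume "cmp A t g" and h: "cmp A t h"
  show "cmp A t (\<lambda>x. LEAST p. prime p \<and> h x < p)"
  proof (rule cmp_Least)
    show "dec A t' (\<lambda>x. prime (k x) \<and> h x < k x)" if "t \<le> t'" "cmp A t' k" for t' k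
      by (intro dec_cmp_intros that(2) cmp_mono[OF h that(1)])
    show "\<exists>i. prime i \<and> h x < i" for x
      using bigger_prime by blast
  qed
qed

lemma cmp_expo:
  assumes f: "cmp A r f" and g: "cmp A r g"
  shows "cmp A r (\<lambda>x. expo (f x) (g x))"
  unfolding expo_def
proof (rule cmp_Least)
  show "dec A t (\<lambda>x. \<not> pr (g x) ^ Suc (h x) dvd f x \<or> f x = 0)" if "r \<le> t" "cmp A t h" for t h
    by (intro dec_cmp_intros cmp_pr that(2) cmp_mono[OF f that(1)] cmp_mono[OF g that(1)])
  show "\<exists>k. \<not> pr (g x) ^ Suc k dvd f x \<or> f x = 0" for x
  proof -
    \<comment> \<open>The number \<open>f x\<close> itself bounds the search: the power with
      exponent \<open>Suc (f x)\<close> exceeds \<open>f x\<close> and cannot divide it unless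
      \<open>f x = 0\<close>.\<close>
    have "f x < pr (g x) ^ f x" "pr (g x) ^ f x \<le> pr (g x) ^ Suc (f x)"
      using prime_gt_1_nat[OF prime_pr[of "g x"]] by (auto intro: power_gt_expt power_increasing)
    then have "\<not> pr (g x) ^ Suc (f x) dvd f x \<or> f x = 0"
      using dvd_imp_le by (metis leD le_less_trans less_le_trans neq0_conv)
    then show ?thesis
      by blast
  qed
qed

lemma cmp_code_length:
  assumes f: "cmp A r f"
  shows "cmp A r (\<lambda>x. code_length (f x))"
  unfolding code_length_def
proof (rule cmp_Least)
  show "dec A t (\<lambda>x. \<not> pr (h x) dvd f x \<or> f x = 0)" if "r \<le> t" "cmp A t h" for t h
    by (intro dec_cmp_intros cmp_pr that(2) cmp_mono[OF f that(1)])
  \<comment> \<open>The prime at position \<open>Suc (f x)\<close> is at least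
    \<open>Suc (f x)\<close>, hence too large to divide a positive \<open>f x\<close>.\<close>
  show "\<exists>i. \<not> pr i dvd f x \<or> f x = 0" for x
    using le_enumerate[OF primes_infinite, of "Suc (f x)"] dvd_imp_le[of "pr (Suc (f x))" "f x"]
    by (intro exI[of _ "Suc (f x)"]) linarith
qed

section \<open>Decidability of the order and of being a path\<close>

lemma path_le_word:
  "path_le (word g) (word h) \<longleftrightarrow>
     code_length g < code_length h \<or>
     code_length g = code_length h \<and>
       ((\<forall>i<code_length g. expo g i = expo h i) \<or>
        (\<exists>i<code_length g. (\<forall>j<i. expo g j = expo h j) \<and> expo g i < expo h i))"
proof -
  have "word g = word h \<longleftrightarrow> code_length g = code_length h \<and> (\<forall>i<code_length g. expo g i = expo h i)"
    by (auto simp: list_eq_iff_nth_eq)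
  moreover have "(word g, word h) \<in> lenlex less_than \<longleftrightarrow> code_length g < code_length h \<or>
      code_length g = code_length h \<and>
        (\<exists>i<code_length g. (\<forall>j<i. expo g j = expo h j) \<and> expo g i < expo h i)"
    by (auto simp: lenlex_conv lex_less_than_iff)
  ultimately show ?thesis
    unfolding path_le_def by blast
qed

lemma dec_path_le_word:
  assumes "cmp A r f" "cmp A r g"
  shows "dec A r (\<lambda>x. path_le (word (f x)) (word (g x)))"
  unfolding path_le_word using assms
  \<comment> \<open>Each quantifier may raise the register bound; \<open>cmp_mono\<close> lifts the
    assumptions on \<open>f\<close>, \<open>g\<close> and the bound variables to the current
    one.\<close>
  by - (rule dec_cmp_intros cmp_code_length cmp_expo | assumption | erule cmp_mono, linarith)+

text \<open>An instruction without branching counts as a branch with two equal targets, so one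
  disjunction covers all labels.\<close>

definition targets :: "('c, 'f, 'r) program \<Rightarrow> nat \<Rightarrow> nat \<times> nat" where
  "targets P l = (case branch (instr_at P l) of None \<Rightarrow> (l + 1, l + 1) | Some ll \<Rightarrow> ll)"

lemma label_succ_targets: "label_succ P l l' \<longleftrightarrow> l' = fst (targets P l) \<or> l' = snd (targets P l)"
  by (auto simp: label_succ_def targets_def split: option.splits)

text \<open>The guards make the jump targets functions of finite support, as \<open>cmp_table\<close> requires.\<close>

lemma word_fin_paths:
  "word g \<in> fin_paths P \<longleftrightarrow>
     0 < code_length g \<and> (\<forall>i<code_length g. 1 \<le> expo g i \<and> expo g i \<le> stop_label P) \<and>
     expo g 0 = 1 \<and> expo g (code_length g - 1) = stop_label P \<and>
     (\<forall>t<code_length g - 1. expo g t < stop_label P \<and>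
        (expo g (Suc t) = (if expo g t < stop_label P then fst (targets P (expo g t)) else 0) \<or>
         expo g (Suc t) = (if expo g t < stop_label P then snd (targets P (expo g t)) else 0)))"
proof (cases "code_length g = 0")
  case True
  then have "word g = []"
    by (simp add: word_def)
  then show ?thesis
    using True by (simp add: fin_paths_def)
next
  case False
  then have ne: "word g \<noteq> []"
    by (metis length_word list.size(3))
  have set: "set (word g) \<subseteq> labels P \<longleftrightarrow> (\<forall>i<code_length g. 1 \<le> expo g i \<and> expo g i \<le> stop_label P)"
    by (auto simp: word_def labels_def image_subset_iff)
  have ends: "hd (word g) = expo g 0" "last (word g) = expo g (code_length g - 1)"
    using False ne by (simp_all add: hd_conv_nth last_conv_nth)
  have "(\<forall>t. t + 1 < length (word g) \<longrightarrow>
        word g ! t \<in> nonstop_labels P \<and> label_succ P (word g ! t) (word g ! (t + 1))) \<longleftrightarrow>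
      (\<forall>t<code_length g - 1. expo g t < stop_label P \<and>
        (expo g (Suc t) = (if expo g t < stop_label P then fst (targets P (expo g t)) else 0) \<or>
         expo g (Suc t) = (if expo g t < stop_label P then snd (targets P (expo g t)) else 0)))"
    if "\<forall>i<code_length g. 1 \<le> expo g i"
    using that by (auto simp: nonstop_labels_def label_succ_targets less_diff_conv)
  then show ?thesis
    unfolding fin_paths_def mem_Collect_eq set ends using False ne by blast
qed

lemma dec_is_code:
  assumes "cmp A r f"
  shows "dec A r (\<lambda>x. is_code P (f x))"
proof -
  have e: "goedel (word g) = (\<Prod>i<code_length g. pr i ^ expo g i)" for g
    by (simp add: goedel_def)
  show ?thesis
    unfolding is_code_def word_fin_paths e using assms
    by - (rule dec_cmp_intros cmp_code_length cmp_expo cmp_pr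
        cmp_table[where h = "\<lambda>l. fst (targets P l)"] cmp_table[where h = "\<lambda>l. snd (targets P l)"]
      | assumption | erule cmp_mono, linarith)+
qed

lemma cmp_code_rank:
  assumes "cmp A r f"
  shows "cmp A r (\<lambda>x. code_rank P (f x))"
  unfolding code_rank_def using assms
  by - (rule dec_cmp_intros dec_is_code dec_path_le_word | assumption | erule cmp_mono, linarith)+

text \<open>The split on finiteness is made in the logic, not by the machine: each case has its own
  code, and the number of paths is a constant in it.\<close>

lemma cmp_capped:
  assumes "cmp A r f"
  shows "cmp A r (\<lambda>x. capped P (f x))"
proof (cases "finite (fin_paths P)")
  case True
  then show ?thesis
    using assms by (simp add: capped_def min_def) (intro cmp_if dec_le cmp_const)
next
  case False
  then show ?thesis
    using assms by (simp add: capped_def)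
qed

lemma cmp_goedel_enum_O:
  assumes "fin_paths P \<noteq> {}" and f: "cmp A r f"
  shows "cmp A r (\<lambda>x. goedel (enum_O P (Suc (f x))))"
proof -
  have e: "goedel (enum_O P (Suc n)) = (LEAST g. is_code P g \<and> code_rank P g = capped P (Suc n))"
    and ex: "\<exists>g. is_code P g \<and> code_rank P g = capped P (Suc n)" for n
    by (rule goedel_enum_O[OF assms(1)], simp)+
  show ?thesis
    unfolding e
  proof (rule cmp_Least)
    show "dec A t (\<lambda>x. is_code P (h x) \<and> code_rank P (h x) = capped P (Suc (f x)))"
      if "r \<le> t" "cmp A t h" for t h
      by (intro dec_cmp_intros dec_is_code cmp_code_rank cmp_capped that(2) cmp_mono[OF f that(1)])
  qed (rule ex)
qed

section \<open>From blocks to machines\<close>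

text \<open>A finite program mentions finitely many registers. The lower bound \<open>m\<close> lets
  the caller demand that a result register belongs to the machine.\<close>

lemma ex_registers:
  assumes "finite C" "\<And>ins. ins \<in> C \<Longrightarrow> wf_instr S {1..} L ins"
  shows "\<exists>k\<ge>m. \<forall>ins\<in>C. wf_instr S {1..k} L ins"
  using assms
proof (induction C)
  case empty
  show ?case
    by auto
next
  case (insert ins C)
  then obtain k where k: "m \<le> k" "\<forall>ins\<in>C. wf_instr S {1..k} L ins"
    by auto
  have "\<exists>n. wf_instr S {1..n} L ins"
  proof (cases ins)
    case (Z_Copy a b)
    then show ?thesis
      using insert.prems[of ins] by (intro exI[of _ "a + b"]) auto
  next
    case (I_Test a b l1 l2)
    then show ?thesis
      using insert.prems[of ins] by (intro exI[of _ "a + b"]) auto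
  qed (use insert.prems[of ins] in auto)
  then obtain n where n: "wf_instr S {1..n} L ins"
    by blast
  have "wf_instr S {1..max n k} L ins"
    by (rule wf_instr_mono[OF n]) auto
  moreover have "wf_instr S {1..max n k} L ins" if "ins \<in> C" for ins
    by (rule wf_instr_mono[OF bspec[OF k(2) that]]) auto
  ultimately show ?case
    using k(1) by (intro exI[of _ "max n k"]) auto
qed

lemma ex_bss_ram:
  assumes "sigma_program (sig_of A) B" "\<And>ins. ins \<in> set B \<Longrightarrow> \<not> is_goto_or ins"
  obtains k where "m \<le> k" "bss_ram A \<lparr>prog = B, regs = k\<rparr>"
proof -
  obtain k where "max m 1 \<le> k" "\<forall>ins\<in>set B. wf_instr (sig_of A) {1..k} (labels B) ins"
    using ex_registers[of "set B" "sig_of A" "labels B" "max m 1"] assms(1)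
    by (auto simp: sigma_program_def)
  then show thesis
    using assms(2) by (intro that[of k]) (auto simp: bss_ram_def A_machine_def)
qed

lemma index_block_no_goto: "index_block A B \<Longrightarrow> ins \<in> set B \<Longrightarrow> \<not> is_goto_or ins"
  by (cases ins) (auto simp: index_block_def)

lemma halts_in_blk:
  assumes "blk A B (I, Z) (I', Z')"
  shows "halts_in A \<lparr>prog = B, regs = k\<rparr> (1, I, Z) I' Z'"
proof -
  let ?M = "\<lparr>prog = B, regs = k\<rparr>"
  have "(step_in A ?M UNIV)\<^sup>*\<^sup>* (0 + 1, I, Z) (0 + length B + 1, I', Z')"
    by (rule blkD[OF assms]) (simp_all add: embeds_self)
  moreover have "step_in A ?M UNIV = step A ?M"
    by (simp add: step_in_def fun_eq_iff)
  ultimately show ?thesis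
    by (simp add: halts_in_def stop_label_def)
qed

text \<open>The label range in \<open>blk\<close> pays off here: a run confined to the block
  executes instructions of \<open>B\<close> only, and all of these are index instructions.\<close>

lemma index_steps_blk:
  assumes "blk A B s s'" "\<forall>ins\<in>set B. is_index_instr ins" "embeds B p (prog M)"
    "{p + 1..p + length B} \<subseteq> L"
  shows "(index_step A M L)\<^sup>*\<^sup>* (p + 1, s) (p + length B + 1, s')"
proof -
  have "index_step A M L c c'" if c: "step_in A M {p + 1..p + length B} c c'" for c c'
  proof -
    define l where "l = fst c - p"
    then have l: "fst c = p + l" "1 \<le> l" "l \<le> length B"
      using c by (auto simp: step_in_def)
    have "is_index_instr (instr_at (prog M) (fst c))"
      using embeds_nth(1)[OF assms(3) l(2,3)] assms(2) l by simp
    then show ?thesis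
      using c assms(4) by (auto simp: index_step_def step_in_def)
  qed
  then have "(index_step A M L)\<^sup>*\<^sup>* c c'" if "(step_in A M {p + 1..p + length B})\<^sup>*\<^sup>* c c'" for c c'
    using that by (rule rtranclp_mono[THEN predicate2D, OF predicate2I])
  then show ?thesis
    using assms(1,3) unfolding blk_def by blast
qed

text \<open>No register besides \<open>j\<close> is touched, because \<open>index_generates\<close>
  forbids additional registers and requires all others to keep their contents.\<close>

primrec load :: "nat \<Rightarrow> nat \<Rightarrow> ('c, 'f, 'r) program" where
  "load j 0 = [I_One j]"
| "load j (Suc n) = load j n ;; [I_Inc j]"

lemma blk_load: "blk A (load j n) (I, Z) (I(j := Suc n), Z)"
proof (induction n)
  case 0
  show ?case
    unfolding load.simps using blk_One[of A j I Z] by (simp only: One_nat_def)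
next
  case (Suc n)
  then show ?case
    using blk_seqb[OF Suc blk_Inc[of A j "I(j := Suc n)" Z]] unfolding load.simps
    by (simp only: fun_upd_same fun_upd_upd)
qed

lemma set_load: "set (load j n) \<subseteq> {I_One j, I_Inc j}"
  by (induction n) (auto simp: seqb_def shift_def)

lemma index_block_load: "1 \<le> j \<Longrightarrow> index_block A (load j n)"
  by (induction n) (simp_all only: load.simps index_block_intros)

lemma insert_block_embeds:
  assumes "p \<le> length (prog M)"
  shows "embeds B p (prog (insert_block B p M))"
  unfolding embeds_def insert_block_def Let_def
  by (intro exI conjI) (use assms in \<open>auto simp: shift_def\<close>)

lemma insert_block_machine:
  assumes "A_machine A M" "p \<le> length (prog M)"
    and "\<forall>ins\<in>set B. wf_instr (sig_of A) {1..regs M} (labels B) ins"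
  shows "A_machine A (insert_block B p M)"
proof -
  let ?h = "\<lambda>l. if l \<le> p + 1 then l else l + length B"
  let ?N = "insert_block B p M"
  have len: "length (prog ?N) = length (prog M) + length B" "regs ?N = regs M"
    by (auto simp: insert_block_def Let_def)
  have 1: "wf_instr (sig_of A) {1..regs M} (labels (prog ?N)) (relabel ?h ins)" if "ins \<in> set (prog M)" for ins
    using assms(1) that by (intro wf_instr_relabel[of _ _ "labels (prog M)"])
      (auto simp: A_machine_def labels_def stop_label_def len)
  have 2: "wf_instr (sig_of A) {1..regs M} (labels (prog ?N)) (relabel (\<lambda>l. l + p) ins)" if "ins \<in> set B" for ins
    using assms(2,3) that by (intro wf_instr_relabel[of _ _ "labels B"])
      (auto simp: labels_def stop_label_def len)
  have "set (prog ?N) \<subseteq> relabel ?h ` set (prog M) \<union> relabel (\<lambda>l. l + p) ` set B"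
    by (auto simp: insert_block_def Let_def dest: in_set_takeD in_set_dropD)
  then show ?thesis
    using assms(1) 1 2 len(2) unfolding A_machine_def by fastforce
qed

lemma index_generates_const:
  fixes A :: "('c, 'f, 'r, 'u) fo_structure"
  assumes "A_machine A M" "j \<in> {1..regs M}" "1 \<le> v"
  shows "index_generates A M j v"
  unfolding index_generates_def
proof (intro exI conjI allI impI ballI)
  let ?B = "load j (v - 1) :: ('c, 'f, 'r) program"
  fix ins :: "('c, 'f, 'r) instr"
  assume "ins \<in> set ?B"
  then have "ins \<in> {I_One j, I_Inc j}"
    using set_load by blast
  then show "is_index_instr ins" "wf_instr (sig_of A) {1..regs M} (labels ?B) ins"
    using assms(2) by auto
next
  let ?B = "load j (v - 1) :: ('c, 'f, 'r) program"
  have B: "is_index_instr ins \<and> wf_instr (sig_of A) {1..regs M} L ins" if "ins \<in> set ?B" for ins L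
    using set_load[of j "v - 1"] that assms(2) by auto
  fix p assume p: "p \<le> length (prog M)"
  show "A_machine A (insert_block ?B p M)"
    using assms(1) p B by (intro insert_block_machine) auto
  fix I Z
  have "blk A ?B (I, Z) (I(j := v), Z)"
    using blk_load[of A j "v - 1" I Z] assms(3) by simp
  then show "(index_step A (insert_block ?B p M) {p + 1..p + length ?B})\<^sup>*\<^sup>*
      (p + 1, I, Z) (p + length ?B + 1, I(j := v), Z)"
    by (rule index_steps_blk) (use B insert_block_embeds[OF p, of ?B] in auto)
qed

text \<open>
  \<open>I\<^sub>2\<close> holds the length of the output, \<open>I\<^sub>4 = 1\<close> is the address of the element that is copied.
\<close>

definition fill :: "('c, 'f, 'r) program" where
  "fill = [I_One 3] ;; [I_One 4] ;; loop 3 2 ([I_Inc 3] ;; [Z_Copy 3 4]) ;; assign 1 2"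

lemma sigma_program_fill:
  fixes A :: "('c, 'f, 'r, 'u) fo_structure"
  shows "sigma_program (sig_of A) fill"
proof -
  have "sigma_program (sig_of A) [Z_Copy 3 4]"
    by (simp add: sigma_program_def)
  moreover have "index_block A (assign 1 2)"
    by (rule index_block_assign) auto
  moreover have "sigma_program (sig_of A) [I_One 3]" "sigma_program (sig_of A) [I_One 4]"
    "sigma_program (sig_of A) [I_Inc 3]"
    by (simp_all add: sigma_program_def)
  ultimately show ?thesis
    unfolding fill_def by (intro sigma_program_seqb sigma_program_loop) (auto simp: index_block_def)
qed

lemma fill_no_goto: "ins \<in> set fill \<Longrightarrow> \<not> is_goto_or ins"
  by (auto simp: fill_def seqb_def loop_def assign_def shift_def)

lemma blk_fill:
  assumes "1 \<le> I 2"
  shows "\<exists>I' Z'. blk A fill (I, Z) (I', Z') \<and> output_of I' Z' = replicate (I 2) (Z 1)"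
proof -
  let ?L = "loop 3 2 ([I_Inc 3] ;; [Z_Copy 3 4])"
  let ?I = "I(3 := 1, 4 := 1)"
  \<comment> \<open>Position 1 holds the value from the start, and \<open>I 3\<close> is incremented
    before each copy; so copies go to positions from 2 on and the source \<open>Z 1\<close>
    survives.\<close>
  define Inv where "Inv J W \<longleftrightarrow> J 2 = I 2 \<and> J 4 = 1 \<and> 1 \<le> J 3 \<and> J 3 \<le> I 2 \<and>
      (\<forall>i. 1 \<le> i \<and> i \<le> J 3 \<longrightarrow> W i = Z 1)" for J :: "nat \<Rightarrow> nat" and W
  have "\<exists>I' Z'. blk A ?L (?I, Z) (I', Z') \<and> Inv I' Z' \<and> I' 3 = I' 2"
  proof (rule blk_loop[where m = "\<lambda>J. I 2 - J 3"])
    show "Inv ?I Z"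
      using assms by (auto simp: Inv_def le_antisym)
    fix J W
    assume J: "Inv J W" "J 3 \<noteq> J 2"
    let ?J = "J(3 := Suc (J 3))"
    let ?W = "W(?J 3 := W (?J 4))"
    have "blk A ([I_Inc 3] ;; [Z_Copy 3 4]) (J, W) (?J, ?W)"
      by (rule blk_seqb[OF blk_Inc blk_Copy])
    moreover have "Inv ?J ?W" "I 2 - ?J 3 < I 2 - J 3"
      using J by (auto simp: Inv_def le_Suc_eq)
    ultimately show "\<exists>I' Z'. blk A ([I_Inc 3] ;; [Z_Copy 3 4]) (J, W) (I', Z') \<and> Inv I' Z' \<and>
        I 2 - I' 3 < I 2 - J 3"
      by blast
  qed
  then obtain J W where J: "blk A ?L (?I, Z) (J, W)" "Inv J W" "J 3 = J 2"
    by blast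
  have 2: "J 2 = I 2"
    using J(2) by (simp add: Inv_def)
  have "blk A (assign 1 2) (J, W) (J(1 := J 2), W)"
    using 2 assms by (intro blk_assign) auto
  then have "blk A fill (I, Z) (J(1 := J 2), W)"
    unfolding fill_def by (intro blk_seqb[OF blk_One] blk_seqb[OF J(1)])
  moreover have "output_of (J(1 := J 2)) W = replicate (I 2) (Z 1)"
    using J(2,3) by (intro nth_equalityI) (auto simp: output_of_def Inv_def simp del: upt_Suc)
  ultimately show ?thesis
    by blast
qed

section \<open>The enumerating and the evaluating machines\<close>

lemma embeds_seqb_left: "embeds B 0 (B ;; C)"
  using embeds_appendD(1)[OF embeds_self[of "B ;; C", unfolded seqb_def] refl]
  by (simp add: seqb_def)

lemma positive_init:
  assumes "xs \<noteq> []"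
  shows "positive (\<lambda>j. if j = 1 then length xs else 1)"
  using assms by (auto simp: positive_def Suc_le_eq)

lemma ex_enumerating_ram:
  fixes A :: "('d, 'g, 's, 'u) fo_structure"
  assumes ne: "fin_paths P \<noteq> {}"
  shows "\<exists>M. bss_ram A M \<and> computes A M (enum_ind P) \<and>
           index_enumerates A M (\<lambda>n. goedel (enum_O P n)) (goedel ` fin_paths P)"
proof -
  \<comment> \<open>Content \<open>n\<close> of register 1 is read as \<open>n - 1\<close>, and a
    result \<open>v\<close> is stored as \<open>v + 1\<close>. \<open>Suc\<close> and
    \<open>- 1\<close> undo both shifts, so register 2 receives the Goedel number itself.\<close>
  let ?f = "\<lambda>x::nat \<Rightarrow> nat. goedel (enum_O P (Suc (x 1))) - 1"
  have "cmp A 1 ?f"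
    by (intro cmp_pred cmp_goedel_enum_O ne cmp_var) auto
  then obtain B where B: "index_block A B" "delivers A 1 B ?f"
    using cmpD by blast
  have "sigma_program (sig_of A) (B ;; fill)"
    using B(1) sigma_program_fill by (intro sigma_program_seqb) (auto simp: index_block_def)
  moreover have "\<not> is_goto_or ins" if "ins \<in> set (B ;; fill)" for ins
    using that by (auto simp: seqb_def shift_def dest: index_block_no_goto[OF B(1)] fill_no_goto)
  ultimately obtain k where k: "2 \<le> k" "bss_ram A \<lparr>prog = B ;; fill, regs = k\<rparr>"
    using ex_bss_ram by blast
  let ?M = "\<lparr>prog = B ;; fill, regs = k\<rparr>"
  have run: "\<exists>I' Z. blk A B (snd (init_config xs)) (I', Z) \<and> Z 1 = hd xs \<and>
      I' 2 = goedel (enum_O P (length xs))" if xs: "xs \<noteq> []" for xs :: "'u list"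
  proof -
    let ?I = "\<lambda>j. if j = 1 then length xs else (1::nat)" and ?Z = "\<lambda>j. xs ! (min j (length xs) - 1)"
    obtain I' where "blk A B (?I, ?Z) (I', ?Z)" "I' (Suc 1) = Suc (?f (\<lambda>j. ?I j - 1))"
      by (rule deliversD[OF B(2) positive_init[OF xs], where Z = ?Z]) blast
    then have "blk A B (snd (init_config xs)) (I', ?Z)" "I' 2 = goedel (enum_O P (length xs))"
      using xs goedel_pos[of "enum_O P (length xs)"] by (simp_all add: init_config_def numeral_2_eq_2)
    then show ?thesis
      using xs by (intro exI[of _ I'] exI[of _ ?Z]) (auto simp: hd_conv_nth min_def Suc_le_eq)
  qed
  have "computes A ?M (enum_ind P)"
    unfolding computes_def
  proof
    fix xs assume "xs \<in> tuples (universe A)"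
    then have "xs \<noteq> []"
      by (simp add: tuples_def)
    then obtain I Z where I: "blk A B (snd (init_config xs)) (I, Z)" "Z 1 = hd xs"
        "I 2 = goedel (enum_O P (length xs))"
      using run by blast
    obtain I' Z' where I': "blk A fill (I, Z) (I', Z')" "output_of I' Z' = replicate (I 2) (Z 1)"
      using blk_fill[of I A Z] I(3) goedel_pos[of "enum_O P (length xs)"] by auto
    have "halts_in A ?M (init_config xs) I' Z'"
      using halts_in_blk[OF blk_seqb[OF I(1)[unfolded init_config_def snd_conv] I'(1)]]
      by (simp add: init_config_def)
    then show "\<exists>I Z. halts_in A ?M (init_config xs) I Z \<and> output_of I Z = enum_ind P xs"
      using I I'(2) by (auto simp: enum_ind_def)
  qed
  moreover have "index_computes A ?M (\<lambda>n. goedel (enum_O P n))"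
    unfolding index_computes_def
  proof (intro bexI ballI)
    \<comment> \<open>The place of observation is the entry of \<open>fill\<close>: up to there only
      the index block \<open>B\<close> has run, and its labels all differ from this one.\<close>
    show "length B + 1 \<in> labels (prog ?M)"
      by (simp add: labels_def stop_label_def)
    show "2 \<in> {1..regs ?M}"
      using k by simp
    fix xs assume "xs \<in> tuples (universe A)"
    then have "xs \<noteq> []"
      by (simp add: tuples_def)
    then obtain I Z where I: "blk A B (snd (init_config xs)) (I, Z)"
        "I 2 = goedel (enum_O P (length xs))"
      using run by blast
    have "(index_step A ?M (- {length B + 1}))\<^sup>*\<^sup>*
        (0 + 1, snd (init_config xs)) (0 + length B + 1, (I, Z))"
      using B(1) by (intro index_steps_blk[OF I(1)]) (auto simp: index_block_def embeds_seqb_left)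
    then have "(index_step A ?M (- {length B + 1}))\<^sup>*\<^sup>* (init_config xs) (length B + 1, I, Z)"
      by (simp add: init_config_def)
    then show "\<exists>I Z. (index_step A ?M (- {length B + 1}))\<^sup>*\<^sup>* (init_config xs) (length B + 1, I, Z) \<and>
        I 2 = goedel (enum_O P (length xs))"
      using I(2) by blast
  qed
  moreover have "(\<lambda>n. goedel (enum_O P n)) ` {1..} = goedel ` fin_paths P"
    using enum_O_image[OF ne] by (simp flip: image_image)
  ultimately show ?thesis
    using k(2) unfolding index_enumerates_def by blast
qed

text \<open>One block serves two machines: one receives the position in register 2, the other first
  loads a fixed position into that register.\<close>

lemma ex_evaluating_block:
  "\<exists>B. index_block A B \<and>
     (\<forall>ls\<in>fin_paths P. \<forall>i\<in>{1..length ls}. \<forall>I Z. positive I \<and> I 1 = goedel ls \<and> I 2 = i \<longrightarrow>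
        (\<exists>I'. blk A B (I, Z) (I', Z) \<and> I' 3 = ls ! (i - 1)))"
proof -
  \<comment> \<open>Register 1 is read as the Goedel number minus 1, whence \<open>Suc\<close>;
    register 2 is read as \<open>i - 1\<close>, which is just the position counted from 0. Since
    labels are positive, \<open>- 1\<close> followed by the shift of \<open>delivers\<close> loses
    nothing.\<close>
  let ?f = "\<lambda>x::nat \<Rightarrow> nat. expo (Suc (x 1)) (x 2) - 1"
  have "cmp A 2 ?f"
    by (intro cmp_pred cmp_expo cmp_Suc cmp_var) auto
  then obtain B where B: "index_block A B" "delivers A 2 B ?f"
    using cmpD by blast
  have "\<exists>I'. blk A B (I, Z) (I', Z) \<and> I' 3 = ls ! (i - 1)"
    if ls: "ls \<in> fin_paths P" "i \<in> {1..length ls}"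
      and I: "positive I" "I 1 = goedel ls" "I 2 = i" for ls i I Z
  proof -
    obtain I' where I': "blk A B (I, Z) (I', Z)" "I' (Suc 2) = Suc (?f (\<lambda>j. I j - 1))"
      by (rule deliversD[OF B(2) I(1), where Z = Z]) blast
    have "i - 1 < length ls"
      using ls(2) by auto
    then have "ls ! (i - 1) \<noteq> 0"
      using fin_paths_pos[OF ls(1)] nth_mem by metis
    then have "I' 3 = ls ! (i - 1)"
      using I'(2) I(2,3) \<open>i - 1 < length ls\<close> goedel_pos[of ls] by (simp add: expo_goedel)
    then show ?thesis
      using I'(1) by blast
  qed
  then show ?thesis
    using B(1) by blast
qed

lemma ex_evaluating_ram:
  "\<exists>M. bss_ram A M \<and> 2 \<le> regs M \<and>
     (\<exists>j\<in>{1..regs M}. \<forall>ls\<in>fin_paths P. \<forall>i\<in>{1..length ls}. \<forall>I Z.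
        proper_state A I Z \<and> I 1 = goedel ls \<and> I 2 = i \<longrightarrow>
        (\<exists>I' Z'. halts_in A M (1, I, Z) I' Z' \<and> I' j = ls ! (i - 1)))"
proof -
  obtain B where B: "index_block A B"
    "\<And>ls i I Z. ls \<in> fin_paths P \<Longrightarrow> i \<in> {1..length ls} \<Longrightarrow> positive I \<Longrightarrow> I 1 = goedel ls \<Longrightarrow>
       I 2 = i \<Longrightarrow> \<exists>I'. blk A B (I, Z) (I', Z) \<and> I' 3 = ls ! (i - 1)"
    using ex_evaluating_block[of A P] by blast
  obtain k where k: "3 \<le> k" "bss_ram A \<lparr>prog = B, regs = k\<rparr>"
    using ex_bss_ram[of A B 3] B(1) index_block_no_goto[OF B(1)] by (auto simp: index_block_def)
  let ?M = "\<lparr>prog = B, regs = k\<rparr>"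
  have "\<exists>I' Z'. halts_in A ?M (1, I, Z) I' Z' \<and> I' 3 = ls ! (i - 1)"
    if "ls \<in> fin_paths P" "i \<in> {1..length ls}" "proper_state A I Z" "I 1 = goedel ls" "I 2 = i"
    for ls i I Z
  proof -
    have "positive I"
      using that(3) by (simp add: proper_state_def positive_def)
    then show ?thesis
      using B(2)[OF that(1,2) _ that(4,5), of Z] halts_in_blk by blast
  qed
  then show ?thesis
    using k by (intro exI[of _ ?M] conjI bexI[of _ 3]) auto
qed

text \<open>The input procedure passes one number only, the length in \<open>I 1\<close>, and sets
  all other index registers to 1. The position \<open>i\<close> therefore has to be built into the
  machine.\<close>

lemma ex_component_ram:
  assumes "1 \<le> i"
  shows "\<exists>M. bss_ram A M \<and>
     (\<exists>j\<in>{1..regs M}. \<forall>ls\<in>fin_paths P. i \<le> length ls \<longrightarrow>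
        (\<forall>xs\<in>tuples (universe A). length xs = goedel ls \<longrightarrow>
           (\<exists>I Z. halts_in A M (init_config xs) I Z \<and> I j = ls ! (i - 1))))"
proof -
  obtain B where B: "index_block A B"
    "\<And>ls i I Z. ls \<in> fin_paths P \<Longrightarrow> i \<in> {1..length ls} \<Longrightarrow> positive I \<Longrightarrow> I 1 = goedel ls \<Longrightarrow>
       I 2 = i \<Longrightarrow> \<exists>I'. blk A B (I, Z) (I', Z) \<and> I' 3 = ls ! (i - 1)"
    using ex_evaluating_block[of A P] by blast
  let ?B = "load 2 (i - 1) ;; B"
  have ib: "index_block A ?B"
    using B(1) by (intro index_block_seqb index_block_load) auto
  obtain k where k: "3 \<le> k" "bss_ram A \<lparr>prog = ?B, regs = k\<rparr>"
    using ex_bss_ram[of A ?B 3] ib index_block_no_goto[OF ib] by (auto simp: index_block_def)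
  let ?M = "\<lparr>prog = ?B, regs = k\<rparr>"
  have "\<exists>I Z. halts_in A ?M (init_config xs) I Z \<and> I 3 = ls ! (i - 1)"
    if ls: "ls \<in> fin_paths P" "i \<le> length ls" and xs: "xs \<in> tuples (universe A)" "length xs = goedel ls"
    for ls xs
  proof -
    let ?I = "\<lambda>j. if j = 1 then length xs else (1::nat)" and ?Z = "\<lambda>j. xs ! (min j (length xs) - 1)"
    have I: "blk A (load 2 (i - 1)) (?I, ?Z) (?I(2 := i), ?Z)"
      using blk_load[of A 2 "i - 1" ?I ?Z] assms by simp
    have "xs \<noteq> []"
      using xs(1) by (simp add: tuples_def)
    then have "positive (?I(2 := i))"
      using assms by (intro positive_upd positive_init)
    then obtain I' where I': "blk A B (?I(2 := i), ?Z) (I', ?Z)" "I' 3 = ls ! (i - 1)"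
      using B(2)[OF ls(1), of i "?I(2 := i)" ?Z] ls(2) xs(2) assms by auto
    have "halts_in A ?M (init_config xs) I' ?Z"
      using halts_in_blk[OF blk_seqb[OF I I'(1)]] by (simp add: init_config_def)
    then show ?thesis
      using I'(2) by blast
  qed
  then show ?thesis
    using k by (intro exI[of _ ?M] conjI bexI[of _ 3]) auto
qed

theorem theorem4p18:
  fixes \<sigma> :: "('c, 'f, 'r) fo_signature"
    and P :: "('c, 'f, 'r) program"
    and A :: "('d, 'g, 's, 'u) fo_structure"
  assumes "finite_signature \<sigma>"
    and "sigma_program \<sigma> P"
    and "fin_paths P \<noteq> {}"
    and "is_fo_structure A"
  shows
    "(\<forall>ls \<in> fin_paths P. \<forall>M. A_machine A M \<longrightarrow>
        (\<forall>j \<in> {1..regs M}. index_generates A M j (goedel ls)))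
     \<and>
     (enum_ind P \<in> tuples (universe A) \<rightarrow> (\<Union>u \<in> universe A. tuples {u})
      \<and> (\<exists>M. bss_ram A M
            \<and> computes A M (enum_ind P)
            \<and> index_enumerates A M (\<lambda>n. goedel (enum_O P n)) (goedel ` fin_paths P)))
     \<and>
     ((\<exists>M. bss_ram A M \<and> 2 \<le> regs M
         \<and> (\<exists>j \<in> {1..regs M}. \<forall>ls \<in> fin_paths P. \<forall>i \<in> {1..length ls}. \<forall>I Z.
              proper_state A I Z \<and> I 1 = goedel ls \<and> I 2 = i \<longrightarrow>
              (\<exists>I' Z'. halts_in A M (1, I, Z) I' Z' \<and> I' j = ls ! (i - 1))))
      \<and> (\<forall>i \<ge> 1. \<exists>M. bss_ram A M
           \<and> (\<exists>j \<in> {1..regs M}. \<forall>ls \<in> fin_paths P. i \<le> length ls \<longrightarrow>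
                (\<forall>xs \<in> tuples (universe A). length xs = goedel ls \<longrightarrow>
                   (\<exists>I Z. halts_in A M (init_config xs) I Z \<and> I j = ls ! (i - 1))))))"
proof (intro conjI)
  show "\<forall>ls \<in> fin_paths P. \<forall>M. A_machine A M \<longrightarrow>
      (\<forall>j \<in> {1..regs M}. index_generates A M j (goedel ls))"
    using index_generates_const goedel_pos by (metis Suc_leI One_nat_def)
  show "enum_ind P \<in> tuples (universe A) \<rightarrow> (\<Union>u \<in> universe A. tuples {u})"
  proof
    fix xs assume "xs \<in> tuples (universe A)"
    then have "hd xs \<in> universe A"
      by (auto simp: tuples_def)
    moreover have "enum_ind P xs \<in> tuples {hd xs}"
      using goedel_pos by (auto simp: enum_ind_def tuples_def)
    ultimately show "enum_ind P xs \<in> (\<Union>u \<in> universe A. tuples {u})"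
      by blast
  qed
qed (use ex_enumerating_ram[OF assms(3)] ex_evaluating_ram ex_component_ram in blast)+

end
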